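(* Let $\mathbb{K}$ be an algebraically closed field and let $n\ge 3$. The ideal $I_{2,n}\subset\mathbb{K}[A]$ is prime. It is minimally generated by the $\binom{n-2}{2}$ quadrics $$a_{i1}a_{j2}-a_{i2}a_{j1}\qquad (3\le i<j\le n)$$ together with the $\binom{n-1}{2}$ cubics $$a_{11}a_{i2}a_{j1}-a_{12}a_{i1}a_{j1}+a_{21}a_{i2}a_{j2}-a_{22}a_{i1}a_{j2}\qquad (3\le i\le j\le n).$$ These polynomials form a Gröbner basis of $I_{2,n}$ with respect to the lexicographic term order, with leading terms $a_{i1}a_{j2}$ and $a_{11}a_{i2}a_{j1}$ respectively. The Hilbert series of the quotient ring $\mathbb{K}[A]/I_{2,n}$ with the standard $\mathbb{N}$-grading equals $$\frac{n}{(1-z)^{n^2-n+2}}-\frac{n-1}{(1-z)^{n^2-n+1}}-\frac{1}{(1-z)^{n^2-2n+4}}+\frac{1}{(1-z)^{n^2-2n+3}}.$$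
   Context: $\mathbb{K}[A]=\mathbb{K}[a_{11},a_{12},\dots,a_{nn}]$ is the polynomial ring in the $n^2$ entries of a generic $n\times n$-matrix $A=(a_{ij})$. Let $A_{11}$ be the upper left $2\times 2$-block of $A$ and $A_{21}$ the lower left $(n-2)\times 2$-block of $A$. The ideal $I_{2,n}$ is generated by all $2\times 2$-minors of the $(2n-4)\times 2$-matrix $\begin{pmatrix}A_{21}\\ A_{21}A_{11}\end{pmatrix}$ (the reduced Kalman matrix for $d=2$). The lexicographic term order is taken with respect to the row-by-row variable order $a_{11}>a_{12}>\cdots>a_{1n}>a_{21}>\cdots>a_{nn}$. *)

theory Defs
  imports
    "HOL-Library.Poly_Mapping"
    "HOL-Library.Product_Lexorder"
    "HOL-Algebra.QuotRing"
    "HOL-Algebra.Embedded_Algebras"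
    "HOL-Computational_Algebra.Formal_Power_Series"
    "HOL-Computational_Algebra.Polynomial"
    "Jordan_Normal_Form.Determinant"
    "Jordan_Normal_Form.DL_Submatrix"
begin

section \<open>The polynomial ring in the entries of a generic matrix\<close>

text \<open>
  The index pair \<open>(i, j)\<close> stands for the variable \<open>a\<^sub>i\<^sub>j\<close> (indices start at 1), a
  monomial is a finitely supported exponent vector, and a polynomial is a finitely supported family
  of coefficients. The type has a variable for every pair of natural numbers; the ring of
  polynomials in the \<open>n\<^sup>2\<close> matrix entries is the carrier of \<open>entry_ring n\<close>.
\<close>

type_synonym monomial = "nat \<times> nat \<Rightarrow>\<^sub>0 nat"
type_synonym 'k entry_poly = "monomial \<Rightarrow>\<^sub>0 'k"

definition entry_ring :: "nat \<Rightarrow> 'k::comm_ring_1 entry_poly ring" where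
  "entry_ring n =
     \<lparr>carrier = {p. \<forall>m \<in> Poly_Mapping.keys p. Poly_Mapping.keys m \<subseteq> {1..n} \<times> {1..n}},
      monoid.mult = (*), one = 1, zero = 0, add = (+)\<rparr>"

definition entry :: "nat \<Rightarrow> nat \<Rightarrow> 'k::comm_ring_1 entry_poly" where
  "entry i j = Poly_Mapping.single (Poly_Mapping.single (i, j) 1) 1"

lemma cring_entry_ring: "cring (entry_ring n :: 'k::comm_ring_1 entry_poly ring)"
proof -
  let ?V = "{1..n} \<times> {1..n}"
  have add: "\<forall>m \<in> Poly_Mapping.keys (p + q). Poly_Mapping.keys m \<subseteq> ?V"
    if "\<forall>m \<in> Poly_Mapping.keys p. Poly_Mapping.keys m \<subseteq> ?V"
      and "\<forall>m \<in> Poly_Mapping.keys q. Poly_Mapping.keys m \<subseteq> ?V" for p q :: "'k entry_poly"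
    using that Poly_Mapping.keys_add[of p q] by blast
  have mult: "\<forall>m \<in> Poly_Mapping.keys (p * q). Poly_Mapping.keys m \<subseteq> ?V"
    if p: "\<forall>m \<in> Poly_Mapping.keys p. Poly_Mapping.keys m \<subseteq> ?V"
      and q: "\<forall>m \<in> Poly_Mapping.keys q. Poly_Mapping.keys m \<subseteq> ?V" for p q :: "'k entry_poly"
  proof
    fix m assume "m \<in> Poly_Mapping.keys (p * q)"
    then obtain a b where "a \<in> Poly_Mapping.keys p" "b \<in> Poly_Mapping.keys q" "m = a + b"
      using keys_mult[of p q] by blast
    then show "Poly_Mapping.keys m \<subseteq> ?V"
      using p q Poly_Mapping.keys_add[of a b] by blast
  qed
  have add': "p \<oplus>\<^bsub>entry_ring n\<^esub> q \<in> carrier (entry_ring n)"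
    if "p \<in> carrier (entry_ring n)" "q \<in> carrier (entry_ring n)" for p q :: "'k entry_poly"
    using that add[of p q] by (simp add: entry_ring_def)
  have mult': "p \<otimes>\<^bsub>entry_ring n\<^esub> q \<in> carrier (entry_ring n)"
    if "p \<in> carrier (entry_ring n)" "q \<in> carrier (entry_ring n)" for p q :: "'k entry_poly"
    using that mult[of p q] by (simp add: entry_ring_def)
  show ?thesis
  proof (rule cringI)
    show "abelian_group (entry_ring n :: 'k entry_poly ring)"
    proof (rule abelian_groupI)
      fix x :: "'k entry_poly" assume "x \<in> carrier (entry_ring n)"
      then show "\<exists>y \<in> carrier (entry_ring n). y \<oplus>\<^bsub>entry_ring n\<^esub> x = \<zero>\<^bsub>entry_ring n\<^esub>"
        by (intro bexI[of _ "- x"]) (simp_all add: entry_ring_def)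
    qed (simp_all only: add', simp_all add: entry_ring_def ac_simps)
    show "comm_monoid (entry_ring n :: 'k entry_poly ring)"
      by (rule comm_monoidI, simp_all only: mult') (simp_all add: entry_ring_def ac_simps)
  qed (simp add: entry_ring_def distrib_right)
qed


section \<open>Ideals, leading terms and Groebner bases\<close>

definition minimally_generates ::
    "('a, 'b) ring_scheme \<Rightarrow> 'a set \<Rightarrow> 'a set \<Rightarrow> bool" where
  "minimally_generates R G I \<longleftrightarrow>
     G \<subseteq> carrier R \<and> Idl\<^bsub>R\<^esub> G = I \<and> (\<forall>H. H \<subset> G \<longrightarrow> Idl\<^bsub>R\<^esub> H \<noteq> I)"

text \<open>
  The linear order that the library puts on finitely supported functions compares two monomials at
  the least index where their exponents differ. Together with the lexicographic order on index
  pairs, this is the lexicographic term order for the row-by-row order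
  \<open>a\<^sub>1\<^sub>1 > a\<^sub>1\<^sub>2 > \<dots> > a\<^sub>1\<^sub>n > a\<^sub>2\<^sub>1 > \<dots> > a\<^sub>n\<^sub>n\<close> of the variables.
\<close>

lemma less_monomial_iff:
  fixes m m' :: monomial
  shows "m < m' \<longleftrightarrow> (\<exists>i j. Poly_Mapping.lookup m (i, j) < Poly_Mapping.lookup m' (i, j) \<and>
           (\<forall>k l. k < i \<or> k = i \<and> l < j \<longrightarrow>
              Poly_Mapping.lookup m (k, l) = Poly_Mapping.lookup m' (k, l)))"
  by (simp add: less_poly_mapping.rep_eq less_fun_def less_prod_simp le_less) blast

text \<open>Meaningful for \<open>p \<noteq> 0\<close> only.\<close>

definition leading_term :: "'k::comm_ring_1 entry_poly \<Rightarrow> 'k entry_poly" where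
  "leading_term p = (let m = Max (Poly_Mapping.keys p)
                     in Poly_Mapping.single m (Poly_Mapping.lookup p m))"

definition is_groebner_basis ::
    "nat \<Rightarrow> 'k::comm_ring_1 entry_poly set \<Rightarrow> 'k entry_poly set \<Rightarrow> bool" where
  "is_groebner_basis n G I \<longleftrightarrow>
     finite G \<and> G \<subseteq> I \<and>
     Idl\<^bsub>entry_ring n\<^esub> (leading_term ` (G - {0})) = Idl\<^bsub>entry_ring n\<^esub> (leading_term ` (I - {0}))"


section \<open>Hilbert series\<close>

definition homogeneous_part :: "nat \<Rightarrow> nat \<Rightarrow> 'k::comm_ring_1 entry_poly set" where
  "homogeneous_part n d =
     {p \<in> carrier (entry_ring n).
        \<forall>m \<in> Poly_Mapping.keys p. (\<Sum>v \<in> Poly_Mapping.keys m. Poly_Mapping.lookup m v) = d}"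

text \<open>
  The image of \<open>homogeneous_part n 0\<close>, the constant polynomials, is the copy of the ground field in
  the quotient; the degree \<open>d\<close> part of the quotient is the image of \<open>homogeneous_part n d\<close>.
\<close>

definition quotient_part ::
    "nat \<Rightarrow> 'k::comm_ring_1 entry_poly set \<Rightarrow> nat \<Rightarrow> 'k entry_poly set set" where
  "quotient_part n I d = (\<lambda>p. I +>\<^bsub>entry_ring n\<^esub> p) ` homogeneous_part n d"

definition hilbert_series :: "nat \<Rightarrow> 'k::field entry_poly set \<Rightarrow> rat fps" where
  "hilbert_series n I =
     Abs_fps (\<lambda>d. of_nat (ring.dim (entry_ring n Quot I) (quotient_part n I 0) (quotient_part n I d)))"


section \<open>The reduced Kalman matrix and its ideal of minors\<close>

text \<open>Matrices are indexed from 0.\<close>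

definition generic_matrix :: "nat \<Rightarrow> 'k::comm_ring_1 entry_poly mat" where
  "generic_matrix n = mat n n (\<lambda>(i, j). entry (i + 1) (j + 1))"

definition reduced_kalman_matrix :: "'a::semiring_0 mat \<Rightarrow> 'a mat" where
  "reduced_kalman_matrix A = (case split_block A 2 2 of
     (A11, A12, A21, A22) \<Rightarrow> A21 @\<^sub>r (A21 * A11))"

definition minors :: "nat \<Rightarrow> 'a::comm_ring_1 mat \<Rightarrow> 'a set" where
  "minors k M = {Determinant.det (submatrix M I J) | I J.
     I \<subseteq> {..<dim_row M} \<and> J \<subseteq> {..<dim_col M} \<and> card I = k \<and> card J = k}"

definition kalman_ideal :: "nat \<Rightarrow> 'k::comm_ring_1 entry_poly set" where
  "kalman_ideal n = Idl\<^bsub>entry_ring n\<^esub> (minors 2 (reduced_kalman_matrix (generic_matrix n)))"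

definition quadric :: "nat \<Rightarrow> nat \<Rightarrow> 'k::comm_ring_1 entry_poly" where
  "quadric i j = entry i 1 * entry j 2 - entry i 2 * entry j 1"

definition cubic :: "nat \<Rightarrow> nat \<Rightarrow> 'k::comm_ring_1 entry_poly" where
  "cubic i j = entry 1 1 * entry i 2 * entry j 1 - entry 1 2 * entry i 1 * entry j 1
             + entry 2 1 * entry i 2 * entry j 2 - entry 2 2 * entry i 1 * entry j 2"

definition quadrics :: "nat \<Rightarrow> 'k::comm_ring_1 entry_poly set" where
  "quadrics n = {quadric i j | i j. 3 \<le> i \<and> i < j \<and> j \<le> n}"

definition cubics :: "nat \<Rightarrow> 'k::comm_ring_1 entry_poly set" where
  "cubics n = {cubic i j | i j. 3 \<le> i \<and> i \<le> j \<and> j \<le> n}"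

end

theory Submission
  imports Defs
begin

text \<open>
  Write \<open>a, b, c, d\<close> for the entries of the upper left block and \<open>x\<^sub>i, y\<^sub>i\<close> for those of row \<open>i \<ge> 3\<close> in
  the first two columns. The Kalman matrix has rank at most 1 iff the rows \<open>(x\<^sub>i, y\<^sub>i)\<close> are multiples
  \<open>s\<^sub>i (1, t)\<close> of a left eigenvector of the upper left block, up to closure. So there is a ring
  homomorphism into Laurent polynomials, which form a domain, with \<open>x\<^sub>i \<mapsto> s\<^sub>i\<close>, \<open>y\<^sub>i \<mapsto> s\<^sub>i t\<close>,
  \<open>a \<mapsto> b / t - c t + d\<close>, and its kernel is a prime ideal that contains the minors. Modulo the quadrics
  and cubics every polynomial reduces to monomials that are divisible by none of the expected leading
  terms, and the images of these standard monomials are linearly independent: each has an extremal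
  exponent in a suitable weight, and distinct standard monomials have distinct extremal exponents.
  Hence the quadrics and cubics generate the kernel, and they form a Groebner basis. The Hilbert series
  counts standard monomials. A generator is indispensable since one of its monomials is divisible by no
  monomial of the others.
\<close>

text \<open>Three inclusions close a circle: the generators lie in the ideal of minors, that ideal
  lies in the kernel, and the kernel lies in the ideal of the generators. Because of the circle no
  S-pair has to be reduced, and the minors of two rows of A21 A11 need not be written in terms of
  the generators. The obstacle to independence is that a maps to a sum of three terms, so a standard
  monomial that contains a does not map to a single Laurent monomial, and supports of images can
  overlap. The inner coefficients of a power of this trinomial are multinomial and may vanish in
  positive characteristic; those at the two ends are 1 or -1. This is why extremal exponents are
  used. Independence is used three times: a standard remainder in the kernel is zero (generation), a
  standard monomial does not lead an element of the kernel (Groebner basis), and the standard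
  monomials of degree d stay independent in the quotient (Hilbert series). Reduction preserves
  degree since the generators are homogeneous, and it divides by no scalar since their leading
  coefficients are 1.\<close>

lemma lookup_single_mult_add:
  fixes p :: "'a::cancel_comm_monoid_add \<Rightarrow>\<^sub>0 'b::semiring_0"
  shows "Poly_Mapping.lookup (Poly_Mapping.single e c * p) (e + k) = c * Poly_Mapping.lookup p k"
proof -
  have "(\<Sum>q. Poly_Mapping.lookup p q when e + k = e + q) = Poly_Mapping.lookup p k"
    by (simp add: eq_commute[of k])
  then show ?thesis
    by (simp add: lookup_mult lookup_single when_mult)
qed

lemma lookup_single_mult_diff:
  fixes p :: "'a::ab_group_add \<Rightarrow>\<^sub>0 'b::semiring_0"
  shows "Poly_Mapping.lookup (Poly_Mapping.single e c * p) k = c * Poly_Mapping.lookup p (k - e)"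
  using lookup_single_mult_add[of e c p "k - e"] by simp

lemma keys_single_mult:
  "Poly_Mapping.keys (Poly_Mapping.single e c * p) \<subseteq> (+) e ` Poly_Mapping.keys p"
  using keys_mult[of "Poly_Mapping.single e c" p] by (auto split: if_splits)

lemma sum_single_keys:
  "(\<Sum>m \<in> Poly_Mapping.keys p. Poly_Mapping.single m (Poly_Mapping.lookup p m)) = p"
proof (rule poly_mapping_eqI)
  fix k
  show "Poly_Mapping.lookup (\<Sum>m \<in> Poly_Mapping.keys p. Poly_Mapping.single m (Poly_Mapping.lookup p m)) k
      = Poly_Mapping.lookup p k"
    by (simp add: lookup_sum lookup_single when_def in_keys_iff)
qed

section \<open>A parametrization of the Kalman variety\<close>

text \<open>
  Laurent monomials in the target: \<open>(1, 1)\<close> stands for \<open>t\<close>, \<open>(i, 1)\<close> with \<open>i \<ge> 3\<close> for \<open>s\<^sub>i\<close>, and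
  every other index pair but the unused \<open>(i, 2)\<close> with \<open>i \<ge> 3\<close> for the matrix entry itself.
\<close>

type_synonym laurent_monomial = "nat \<times> nat \<Rightarrow>\<^sub>0 int"

text \<open>Only the monomial factor of the image. The exponent of a is left out: index (1, 1) now
  belongs to t, and \<open>param\<close> multiplies by the power of \<open>param_a\<close>
  separately.\<close>

definition param_exponent :: "nat \<Rightarrow> monomial \<Rightarrow> laurent_monomial" where
  "param_exponent n m = Abs_poly_mapping (\<lambda>(i, j).
     if i = 1 \<and> j = 1 then \<Sum>k=3..n. int (Poly_Mapping.lookup m (k, 2))
     else if 3 \<le> i \<and> j = 1 then int (Poly_Mapping.lookup m (i, 1)) + int (Poly_Mapping.lookup m (i, 2))
     else if 3 \<le> i \<and> j = 2 then 0
     else int (Poly_Mapping.lookup m (i, j)))"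

lemma lookup_param_exponent:
  "Poly_Mapping.lookup (param_exponent n m) (i, j) =
    (if i = 1 \<and> j = 1 then \<Sum>k=3..n. int (Poly_Mapping.lookup m (k, 2))
     else if 3 \<le> i \<and> j = 1 then int (Poly_Mapping.lookup m (i, 1)) + int (Poly_Mapping.lookup m (i, 2))
     else if 3 \<le> i \<and> j = 2 then 0
     else int (Poly_Mapping.lookup m (i, j)))"
proof -
  let ?f = "\<lambda>(i, j).
     if i = 1 \<and> j = 1 then \<Sum>k=3..n. int (Poly_Mapping.lookup m (k, 2))
     else if 3 \<le> i \<and> j = 1 then int (Poly_Mapping.lookup m (i, 1)) + int (Poly_Mapping.lookup m (i, 2))
     else if 3 \<le> i \<and> j = 2 then 0
     else int (Poly_Mapping.lookup m (i, j))"
  \<comment> \<open>The pair (i, 1) also collects the exponent of (i, 2), so the support can leave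
    the keys of \<open>m\<close>; it stays within them, their projection to column 1, and the index
    of t.\<close>
  have zero: "?f (i, j) = 0" if "(i, j) \<noteq> (1, 1)" "(i, j) \<notin> Poly_Mapping.keys m"
    "(i, j) \<notin> (\<lambda>(i, j). (i, 1)) ` Poly_Mapping.keys m" for i j
  proof -
    have "(i, 1) \<notin> Poly_Mapping.keys m \<and> (i, 2) \<notin> Poly_Mapping.keys m" if "j = 1"
      using \<open>(i, j) \<notin> (\<lambda>(i, j). (i, 1)) ` Poly_Mapping.keys m\<close> that by force
    then show ?thesis
      using that by (auto simp: in_keys_iff)
  qed
  have "{v. ?f v \<noteq> 0} \<subseteq> insert (1, 1)
      (Poly_Mapping.keys m \<union> (\<lambda>(i, j). (i, 1)) ` Poly_Mapping.keys m)"
  proof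
    fix v
    assume "v \<in> {v. ?f v \<noteq> 0}"
    then show "v \<in> insert (1, 1) (Poly_Mapping.keys m \<union> (\<lambda>(i, j). (i, 1)) ` Poly_Mapping.keys m)"
      using zero[of "fst v" "snd v"] by auto
  qed
  then have "finite {v. ?f v \<noteq> 0}"
    by (rule finite_subset) simp
  then have "Poly_Mapping.lookup (param_exponent n m) = ?f"
    unfolding param_exponent_def by (rule lookup_Abs_poly_mapping)
  then show ?thesis
    by simp
qed

lemma param_exponent_add: "param_exponent n (m + m') = param_exponent n m + param_exponent n m'"
  by (rule poly_mapping_eqI, clarify)
    (simp add: lookup_param_exponent lookup_add sum.distrib)

lemma param_exponent_0: "param_exponent n 0 = 0"
  by (rule poly_mapping_eqI, clarify) (simp add: lookup_param_exponent)

definition exp_b_over_t :: laurent_monomial where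
  "exp_b_over_t = Poly_Mapping.single (1, 2) 1 - Poly_Mapping.single (1, 1) 1"

definition exp_ct :: laurent_monomial where
  "exp_ct = Poly_Mapping.single (2, 1) 1 + Poly_Mapping.single (1, 1) 1"

definition exp_d :: laurent_monomial where
  "exp_d = Poly_Mapping.single (2, 2) 1"

text \<open>
  The row \<open>(1, t)\<close> is a left eigenvector of the upper left block with rows \<open>(a, b)\<close> and \<open>(c, d)\<close>
  iff \<open>(a + c t) t = b + d t\<close>; solve for \<open>a\<close>.
\<close>

definition param_a :: "laurent_monomial \<Rightarrow>\<^sub>0 'k::comm_ring_1" where
  "param_a = Poly_Mapping.single exp_b_over_t 1 - Poly_Mapping.single exp_ct 1
    + Poly_Mapping.single exp_d 1"

definition param :: "nat \<Rightarrow> 'k::comm_ring_1 entry_poly \<Rightarrow> (laurent_monomial \<Rightarrow>\<^sub>0 'k)" where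
  "param n p = (\<Sum>m \<in> Poly_Mapping.keys p.
     Poly_Mapping.single (param_exponent n m) (Poly_Mapping.lookup p m)
       * param_a ^ Poly_Mapping.lookup m (1, 1))"

text \<open>Cancellation makes the keys of a sum unpredictable; additivity needs one common index
  set for both summands and the sum.\<close>

lemma param_eq_sum:
  assumes "finite M" "Poly_Mapping.keys p \<subseteq> M"
  shows "param n p = (\<Sum>m \<in> M. Poly_Mapping.single (param_exponent n m) (Poly_Mapping.lookup p m)
       * param_a ^ Poly_Mapping.lookup m (1, 1))"
  unfolding param_def using assms by (intro sum.mono_neutral_left) (auto simp: in_keys_iff)

lemma param_0 [simp]: "param n 0 = 0"
  by (simp add: param_def)

lemma param_single:
  "param n (Poly_Mapping.single m c) =
    Poly_Mapping.single (param_exponent n m) c * param_a ^ Poly_Mapping.lookup m (1, 1)"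
  by (subst param_eq_sum[of "{m}"]) auto

lemma param_add: "param n (p + q) = param n p + param n q"
proof -
  let ?M = "Poly_Mapping.keys p \<union> Poly_Mapping.keys q"
  have "Poly_Mapping.keys (p + q) \<subseteq> ?M"
    by (rule Poly_Mapping.keys_add)
  then show ?thesis
    by (subst (1 2 3) param_eq_sum[of ?M])
      (auto simp: lookup_add single_add distrib_right sum.distrib)
qed

lemma param_sum: "param n (sum f A) = (\<Sum>a\<in>A. param n (f a))"
  by (induction A rule: infinite_finite_induct) (simp_all add: param_add)

lemma param_diff: "param n (p - q) = param n p - param n q"
  using param_add[of n "p - q" q] by simp

lemma param_1 [simp]: "param n 1 = 1"
  using param_single[of n 0 1] by (simp add: param_exponent_0)

lemma param_single_mult_single:
  "param n (Poly_Mapping.single m c * Poly_Mapping.single m' c') =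
    param n (Poly_Mapping.single m c) * param n (Poly_Mapping.single m' c')"
proof -
  have "param n (Poly_Mapping.single m c * Poly_Mapping.single m' c') =
    Poly_Mapping.single (param_exponent n m) c * Poly_Mapping.single (param_exponent n m') c'
      * (param_a ^ Poly_Mapping.lookup m (1, 1) * param_a ^ Poly_Mapping.lookup m' (1, 1))"
    by (simp add: mult_single param_single param_exponent_add lookup_add power_add)
  then show ?thesis
    by (simp add: param_single ac_simps)
qed

lemma param_mult: "param n (p * q) = param n p * param n q"
proof -
  let ?s = "\<lambda>p m. Poly_Mapping.single m (Poly_Mapping.lookup p m)"
  have "p * q = (\<Sum>m \<in> Poly_Mapping.keys p. \<Sum>m' \<in> Poly_Mapping.keys q. ?s p m * ?s q m')"
    unfolding sum_product[symmetric] sum_single_keys ..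
  then have "param n (p * q) =
      (\<Sum>m \<in> Poly_Mapping.keys p. \<Sum>m' \<in> Poly_Mapping.keys q. param n (?s p m * ?s q m'))"
    by (simp add: param_sum)
  also have "\<dots> = (\<Sum>m \<in> Poly_Mapping.keys p. \<Sum>m' \<in> Poly_Mapping.keys q.
      param n (?s p m) * param n (?s q m'))"
    by (simp only: param_single_mult_single)
  also have "\<dots> = param n (\<Sum>m \<in> Poly_Mapping.keys p. ?s p m) * param n (\<Sum>m \<in> Poly_Mapping.keys q. ?s q m)"
    by (simp add: sum_product param_sum)
  finally show ?thesis
    by (simp add: sum_single_keys)
qed

section \<open>Powers of the image of a\<close>

text \<open>The terms b/t, ct and d of \<open>param_a\<close> have t-degrees -1, 1 and 0. A product
  of \<alpha> of them reaches t-degree -\<alpha> or \<alpha> only by taking the first or the second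
  term every time, and no s_i ever occurs. \<open>frag_cmul\<close> scales an exponent vector by an
  integer.\<close>

lemma lookup_param_a_power:
  fixes \<alpha> :: nat
  shows "Poly_Mapping.lookup (param_a ^ \<alpha> :: laurent_monomial \<Rightarrow>\<^sub>0 'k::comm_ring_1) k \<noteq> 0 \<Longrightarrow>
      - int \<alpha> \<le> Poly_Mapping.lookup k (1, 1) \<and> Poly_Mapping.lookup k (1, 1) \<le> int \<alpha>
      \<and> (Poly_Mapping.lookup k (1, 1) = - int \<alpha> \<longrightarrow> k = frag_cmul (int \<alpha>) exp_b_over_t)
      \<and> (Poly_Mapping.lookup k (1, 1) = int \<alpha> \<longrightarrow> k = frag_cmul (int \<alpha>) exp_ct)
      \<and> (\<forall>i\<ge>3. Poly_Mapping.lookup k (i, 1) = 0)"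
proof (induction \<alpha> arbitrary: k)
  case 0
  then show ?case
    by (auto simp: lookup_one when_def split: if_splits)
next
  case (Suc \<alpha>)
  have "Poly_Mapping.lookup (param_a ^ Suc \<alpha> :: laurent_monomial \<Rightarrow>\<^sub>0 'k) k
     = Poly_Mapping.lookup (param_a ^ \<alpha> :: laurent_monomial \<Rightarrow>\<^sub>0 'k) (k - exp_b_over_t)
     - Poly_Mapping.lookup (param_a ^ \<alpha> :: laurent_monomial \<Rightarrow>\<^sub>0 'k) (k - exp_ct)
     + Poly_Mapping.lookup (param_a ^ \<alpha> :: laurent_monomial \<Rightarrow>\<^sub>0 'k) (k - exp_d)"
    by (simp add: param_a_def left_diff_distrib distrib_right lookup_add lookup_minus lookup_single_mult_diff)
  then consider "Poly_Mapping.lookup (param_a ^ \<alpha> :: laurent_monomial \<Rightarrow>\<^sub>0 'k) (k - exp_b_over_t) \<noteq> 0"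
    | "Poly_Mapping.lookup (param_a ^ \<alpha> :: laurent_monomial \<Rightarrow>\<^sub>0 'k) (k - exp_ct) \<noteq> 0"
    | "Poly_Mapping.lookup (param_a ^ \<alpha> :: laurent_monomial \<Rightarrow>\<^sub>0 'k) (k - exp_d) \<noteq> 0"
    using Suc.prems by fastforce
  then show ?case
  proof cases
    case 1
    from Suc.IH[OF this] show ?thesis
      by (auto simp: exp_b_over_t_def lookup_minus lookup_add lookup_single when_def
          frag_cmul_distrib algebra_simps)
  next
    case 2
    from Suc.IH[OF this] show ?thesis
      by (auto simp: exp_ct_def lookup_minus lookup_add lookup_single when_def
          frag_cmul_distrib algebra_simps)
  next
    case 3
    from Suc.IH[OF this] show ?thesis
      by (auto simp: exp_d_def lookup_minus lookup_add lookup_single when_def)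
  qed
qed

text \<open>Each end of the expansion arises from a single choice of terms, so its coefficient is a
  unit over every coefficient ring.\<close>

lemma lookup_param_a_power_extremal:
  fixes \<alpha> :: nat
  shows "Poly_Mapping.lookup (param_a ^ \<alpha> :: laurent_monomial \<Rightarrow>\<^sub>0 'k::comm_ring_1)
        (frag_cmul (int \<alpha>) exp_b_over_t) = 1
    \<and> Poly_Mapping.lookup (param_a ^ \<alpha> :: laurent_monomial \<Rightarrow>\<^sub>0 'k)
        (frag_cmul (int \<alpha>) exp_ct) = (- 1) ^ \<alpha>"
proof (induction \<alpha>)
  case 0
  show ?case by simp
next
  case (Suc \<alpha>)
  let ?A = "param_a ^ \<alpha> :: laurent_monomial \<Rightarrow>\<^sub>0 'k"
  have step: "Poly_Mapping.lookup (param_a ^ Suc \<alpha> :: laurent_monomial \<Rightarrow>\<^sub>0 'k) k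
     = Poly_Mapping.lookup ?A (k - exp_b_over_t) - Poly_Mapping.lookup ?A (k - exp_ct)
     + Poly_Mapping.lookup ?A (k - exp_d)" for k
    by (simp add: param_a_def left_diff_distrib distrib_right lookup_add lookup_minus lookup_single_mult_diff)
  have zero: "Poly_Mapping.lookup ?A k = 0" if "\<bar>Poly_Mapping.lookup k (1, 1)\<bar> > int \<alpha>" for k
    using lookup_param_a_power[of \<alpha> k, where 'k='k] that by force
  let ?b = "frag_cmul (int (Suc \<alpha>)) exp_b_over_t" and ?c = "frag_cmul (int (Suc \<alpha>)) exp_ct"
  have "?b - exp_b_over_t = frag_cmul (int \<alpha>) exp_b_over_t" "?c - exp_ct = frag_cmul (int \<alpha>) exp_ct"
    by (simp_all add: frag_cmul_distrib)
  \<comment> \<open>These four exponents have t-degree at least \<alpha> + 1 in absolute value, out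
    of reach for the power \<alpha>. One summand of \<open>step\<close> survives at each
    end.\<close>
  moreover have "Poly_Mapping.lookup ?A (?b - exp_ct) = 0" "Poly_Mapping.lookup ?A (?b - exp_d) = 0"
    "Poly_Mapping.lookup ?A (?c - exp_b_over_t) = 0" "Poly_Mapping.lookup ?A (?c - exp_d) = 0"
    by (rule zero; simp add: exp_b_over_t_def exp_ct_def exp_d_def lookup_minus lookup_add
        lookup_single when_def)+
  ultimately show ?case
    using Suc.IH by (simp only: step) simp
qed

section \<open>Standard monomials and the independence of their images\<close>

definition monomials :: "nat \<Rightarrow> monomial set" where
  "monomials n = {m. Poly_Mapping.keys m \<subseteq> {1..n} \<times> {1..n}}"

definition standard_monomials :: "nat \<Rightarrow> monomial set" where
  "standard_monomials n = {m \<in> monomials n.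
     (\<forall>i j. 3 \<le> i \<and> i < j \<and> j \<le> n \<longrightarrow> Poly_Mapping.lookup m (i, 1) = 0 \<or> Poly_Mapping.lookup m (j, 2) = 0) \<and>
     (\<forall>i j. 3 \<le> i \<and> i \<le> j \<and> j \<le> n \<longrightarrow> Poly_Mapping.lookup m (1, 1) = 0
        \<or> Poly_Mapping.lookup m (i, 2) = 0 \<or> Poly_Mapping.lookup m (j, 1) = 0)}"

lemma standard_x_y:
  assumes "m \<in> standard_monomials n" "3 \<le> i" "i < j" "j \<le> n"
  shows "Poly_Mapping.lookup m (i, 1) = 0 \<or> Poly_Mapping.lookup m (j, 2) = 0"
proof -
  have "\<forall>i j. 3 \<le> i \<and> i < j \<and> j \<le> n \<longrightarrow>
      Poly_Mapping.lookup m (i, 1) = 0 \<or> Poly_Mapping.lookup m (j, 2) = 0"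
    using assms(1) unfolding standard_monomials_def by (elim CollectE conjE)
  then show ?thesis
    by (elim allE[of _ i] allE[of _ j] mp) (simp add: assms)
qed

lemma standard_a_y_x:
  assumes "m \<in> standard_monomials n" "3 \<le> i" "i \<le> j" "j \<le> n"
  shows "Poly_Mapping.lookup m (1, 1) = 0 \<or> Poly_Mapping.lookup m (i, 2) = 0
    \<or> Poly_Mapping.lookup m (j, 1) = 0"
proof -
  have "\<forall>i j. 3 \<le> i \<and> i \<le> j \<and> j \<le> n \<longrightarrow> Poly_Mapping.lookup m (1, 1) = 0
      \<or> Poly_Mapping.lookup m (i, 2) = 0 \<or> Poly_Mapping.lookup m (j, 1) = 0"
    using assms(1) unfolding standard_monomials_def by (elim CollectE conjE)
  then show ?thesis
    by (elim allE[of _ i] allE[of _ j] mp) (simp add: assms)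
qed

definition x_degree :: "nat \<Rightarrow> monomial \<Rightarrow> nat" where
  "x_degree n m = (\<Sum>i=3..n. Poly_Mapping.lookup m (i, 1))"

definition y_degree :: "nat \<Rightarrow> monomial \<Rightarrow> nat" where
  "y_degree n m = (\<Sum>i=3..n. Poly_Mapping.lookup m (i, 2))"

text \<open>If y_i and x_j both occur, the quadrics force i \<le> j, and then a would complete the
  leading term a y_i x_j of a cubic. So a occurs only beside x's alone or y's alone.\<close>

lemma standard_a_free:
  assumes "m \<in> standard_monomials n" "x_degree n m \<noteq> 0" "y_degree n m \<noteq> 0"
  shows "Poly_Mapping.lookup m (1, 1) = 0"
proof -
  obtain i where i: "3 \<le> i" "i \<le> n" "Poly_Mapping.lookup m (i, 2) \<noteq> 0"
    using assms(3) by (auto simp: y_degree_def)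
  obtain j where j: "3 \<le> j" "j \<le> n" "Poly_Mapping.lookup m (j, 1) \<noteq> 0"
    using assms(2) by (auto simp: x_degree_def)
  have "i \<le> j"
    using standard_x_y[OF assms(1) j(1) _ i(2)] i j by (metis not_le)
  then show ?thesis
    using standard_a_y_x[OF assms(1) i(1) _ j(2)] i j by metis
qed

text \<open>Standard monomials without a have t-exponent in [0, P], where P is the number of x's and
  y's with multiplicity. The end chosen here points away from that interval, so that P and the
  t-exponent together reveal the y-degree and the exponent of a.\<close>

definition extremal_exponent :: "nat \<Rightarrow> monomial \<Rightarrow> laurent_monomial" where
  "extremal_exponent n m = param_exponent n m
     + frag_cmul (int (Poly_Mapping.lookup m (1, 1))) (if y_degree n m = 0 then exp_b_over_t else exp_ct)"

text \<open>
  With \<open>P = x_degree + y_degree\<close> fixed, the exponents of \<open>t\<close> in the image of a standard monomial with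
  \<open>a\<close>-exponent \<open>\<alpha>\<close> range over \<open>[-\<alpha>, \<alpha>]\<close> or \<open>[P - \<alpha>, P + \<alpha>]\<close> or are strictly between \<open>0\<close> and \<open>P\<close>.
  The distance from \<open>P/2\<close> singles out one end of the range; the shift by \<open>1/4\<close> breaks the
  tie for \<open>P = 0\<close>.
\<close>

definition weight :: "nat \<Rightarrow> laurent_monomial \<Rightarrow> int" where
  "weight n k = \<bar>4 * Poly_Mapping.lookup k (1, 1) - 2 * (\<Sum>i=3..n. Poly_Mapping.lookup k (i, 1)) - 1\<bar>"

lemma s_degree_param_exponent:
  "(\<Sum>i=3..n. Poly_Mapping.lookup (param_exponent n m) (i, 1)) = int (x_degree n m + y_degree n m)"
  by (simp add: lookup_param_exponent x_degree_def y_degree_def sum.distrib)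

lemma t_degree_param_exponent:
  "Poly_Mapping.lookup (param_exponent n m) (1, 1) = int (y_degree n m)"
  by (simp add: lookup_param_exponent y_degree_def)

lemma weight_param_exponent_add:
  assumes "\<forall>i\<ge>3. Poly_Mapping.lookup k (i, 1) = 0"
  shows "weight n (param_exponent n m + k) =
    \<bar>4 * (int (y_degree n m) + Poly_Mapping.lookup k (1, 1)) - 2 * int (x_degree n m + y_degree n m) - 1\<bar>"
proof -
  have "(\<Sum>i=3..n. Poly_Mapping.lookup k (i, 1)) = 0"
    using assms by (intro sum.neutral) auto
  then show ?thesis
    unfolding weight_def lookup_add sum.distrib s_degree_param_exponent t_degree_param_exponent by simp
qed

lemma lookup_exp_multiples:
  "Poly_Mapping.lookup (frag_cmul \<alpha> exp_b_over_t) (1, 1) = - \<alpha>"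
  "Poly_Mapping.lookup (frag_cmul \<alpha> exp_ct) (1, 1) = \<alpha>"
  "\<forall>i\<ge>3. Poly_Mapping.lookup (frag_cmul \<alpha> exp_b_over_t) (i, 1) = 0"
  "\<forall>i\<ge>3. Poly_Mapping.lookup (frag_cmul \<alpha> exp_ct) (i, 1) = 0"
  by (simp_all add: exp_b_over_t_def exp_ct_def lookup_add lookup_minus lookup_single when_def)

lemma weight_extremal_exponent:
  "weight n (extremal_exponent n m) =
    (if y_degree n m = 0 then 4 * int (Poly_Mapping.lookup m (1, 1)) + 2 * int (x_degree n m) + 1
     else \<bar>4 * int (Poly_Mapping.lookup m (1, 1)) + 2 * int (y_degree n m) - 2 * int (x_degree n m) - 1\<bar>)"
  unfolding extremal_exponent_def
  using weight_param_exponent_add[OF lookup_exp_multiples(3), of n m "int (Poly_Mapping.lookup m (1, 1))",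
      unfolded lookup_exp_multiples]
    weight_param_exponent_add[OF lookup_exp_multiples(4), of n m "int (Poly_Mapping.lookup m (1, 1))",
      unfolded lookup_exp_multiples]
  by (simp add: algebra_simps split: if_splits)

text \<open>The weight is a convex function of the t-exponent, so over the range of one image it is
  largest at an end, and by \<open>lookup_param_a_power\<close> each end of the range carries just
  one exponent vector. The two cases check that the chosen end beats the opposite one.\<close>

lemma weight_less_extremal:
  assumes m: "m \<in> standard_monomials n"
    and k: "Poly_Mapping.lookup (param_a ^ Poly_Mapping.lookup m (1, 1) :: laurent_monomial \<Rightarrow>\<^sub>0 'k::comm_ring_1)
      (k - param_exponent n m) \<noteq> 0"
    and neq: "k \<noteq> extremal_exponent n m"
  shows "weight n k < weight n (extremal_exponent n m)"
proof -
  define l where "l = k - param_exponent n m"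
  define \<alpha> where "\<alpha> = Poly_Mapping.lookup m (1, 1)"
  have k_eq: "k = param_exponent n m + l"
    by (simp add: l_def)
  let ?\<tau> = "Poly_Mapping.lookup l (1, 1)"
  have l: "- int \<alpha> \<le> ?\<tau>" "?\<tau> \<le> int \<alpha>" "?\<tau> = - int \<alpha> \<longrightarrow> l = frag_cmul (int \<alpha>) exp_b_over_t"
    "?\<tau> = int \<alpha> \<longrightarrow> l = frag_cmul (int \<alpha>) exp_ct" "\<forall>i\<ge>3. Poly_Mapping.lookup l (i, 1) = 0"
    using lookup_param_a_power[OF k] by (simp_all add: l_def \<alpha>_def)
  have wk: "weight n k = \<bar>4 * (int (y_degree n m) + ?\<tau>) - 2 * int (x_degree n m + y_degree n m) - 1\<bar>"
    unfolding k_eq by (rule weight_param_exponent_add) (rule l)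
  show ?thesis
  proof (cases "y_degree n m = 0")
    case True
    have "?\<tau> \<noteq> - int \<alpha>"
      using l(3) neq True by (auto simp: k_eq extremal_exponent_def \<alpha>_def)
    then show ?thesis
      using l(1,2) wk True unfolding weight_extremal_exponent by (simp add: \<alpha>_def)
  next
    case False
    have \<tau>: "?\<tau> \<noteq> int \<alpha>"
      using l(4) neq False by (auto simp: k_eq extremal_exponent_def \<alpha>_def)
    \<comment> \<open>A second exponent in the support needs a positive power of
      \<open>param_a\<close>. A y is present, so standardness now excludes every x and P is the
      y-degree.\<close>
    then have "\<alpha> \<noteq> 0"
      using l(1,2) by auto
    then have "x_degree n m = 0"
      using standard_a_free[OF m] False by (auto simp: \<alpha>_def)
    then show ?thesis
      using l(1,2) wk False \<tau> unfolding weight_extremal_exponent by (simp add: \<alpha>_def)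
  qed
qed

lemma lookup_extremal:
  "Poly_Mapping.lookup (param_a ^ Poly_Mapping.lookup m (1, 1) :: laurent_monomial \<Rightarrow>\<^sub>0 'k::comm_ring_1)
      (extremal_exponent n m - param_exponent n m) \<in> {1, (- 1) ^ Poly_Mapping.lookup m (1, 1)}"
  using lookup_param_a_power_extremal[of "Poly_Mapping.lookup m (1, 1)", where 'k='k]
  by (auto simp: extremal_exponent_def)

text \<open>The s-exponents give P, the t-exponent then gives the y-degree and the exponent of a,
  and removing the known multiple leaves \<open>param_exponent\<close>. This determines the free
  variables and every sum x_i + y_i of exponents. The split of these sums is forced because in a
  standard monomial no x stands in a row above a y.\<close>

lemma extremal_exponent_inj:
  assumes m: "m \<in> standard_monomials n" and m': "m' \<in> standard_monomials n"
    and eq: "extremal_exponent n m = extremal_exponent n m'"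
  shows "m = m'"
proof -
  define E where "E = extremal_exponent n m"
  have E: "E = extremal_exponent n m" "E = extremal_exponent n m'"
    using eq by (simp_all add: E_def)
  have P: "(\<Sum>i=3..n. Poly_Mapping.lookup (extremal_exponent n m) (i, 1))
      = int (x_degree n m + y_degree n m)" for m
  proof -
    have "(\<Sum>i=3..n. Poly_Mapping.lookup (extremal_exponent n m) (i, 1))
        = (\<Sum>i=3..n. Poly_Mapping.lookup (param_exponent n m) (i, 1))"
      by (intro sum.cong refl) (simp add: extremal_exponent_def exp_b_over_t_def exp_ct_def
          lookup_add lookup_minus lookup_single when_def)
    then show ?thesis
      by (simp only: s_degree_param_exponent)
  qed
  have t: "Poly_Mapping.lookup (extremal_exponent n m) (1, 1) =
      (if y_degree n m = 0 then - int (Poly_Mapping.lookup m (1, 1))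
       else int (y_degree n m + Poly_Mapping.lookup m (1, 1)))" for m
    unfolding extremal_exponent_def lookup_add t_degree_param_exponent
    by (simp add: exp_b_over_t_def exp_ct_def lookup_add lookup_minus lookup_single when_def)
  have sum_eq: "x_degree n m + y_degree n m = x_degree n m' + y_degree n m'"
    using P[of m] P[of m'] eq by simp
  have t_eq: "(if y_degree n m = 0 then - int (Poly_Mapping.lookup m (1, 1))
       else int (y_degree n m + Poly_Mapping.lookup m (1, 1))) =
     (if y_degree n m' = 0 then - int (Poly_Mapping.lookup m' (1, 1))
       else int (y_degree n m' + Poly_Mapping.lookup m' (1, 1)))"
    using t[of m] t[of m'] eq by simp
  have "x_degree n m = 0 \<or> y_degree n m = 0 \<or> Poly_Mapping.lookup m (1, 1) = 0"
    using standard_a_free[OF m] by metis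
  moreover have "x_degree n m' = 0 \<or> y_degree n m' = 0 \<or> Poly_Mapping.lookup m' (1, 1) = 0"
    using standard_a_free[OF m'] by metis
  \<comment> \<open>Compare the t-exponent with 0 and P: below 0 there is no y, above P there is no
    x, and in between a is absent.\<close>
  ultimately have y_eq: "y_degree n m = y_degree n m'" and a_eq: "Poly_Mapping.lookup m (1, 1) = Poly_Mapping.lookup m' (1, 1)"
    using sum_eq t_eq by (auto split: if_splits)
  have "param_exponent n m = param_exponent n m'"
    using eq y_eq a_eq by (simp add: extremal_exponent_def)
  then have pe: "Poly_Mapping.lookup (param_exponent n m) v = Poly_Mapping.lookup (param_exponent n m') v" for v
    by simp
  have xy: "Poly_Mapping.lookup m (i, 1) + Poly_Mapping.lookup m (i, 2)
      = Poly_Mapping.lookup m' (i, 1) + Poly_Mapping.lookup m' (i, 2)" if "3 \<le> i" for i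
    using pe[of "(i, 1)"] that by (simp add: lookup_param_exponent)
  \<comment> \<open>An exchange argument. If \<open>m\<close> has more y than \<open>m'\<close> in
    row i, equal y-degrees give a row j with the opposite inequality. Equal row sums then put x_i
    y_j into \<open>m'\<close> and x_j y_i into \<open>m\<close>, which forbids both i < j and j <
    i. The lemma is stated for arbitrary \<open>m\<close>, \<open>m'\<close> in order to be used in
    both directions.\<close>
  have le: "Poly_Mapping.lookup m (i, 2) \<le> Poly_Mapping.lookup m' (i, 2)"
    if i: "3 \<le> i" "i \<le> n" and m: "m \<in> standard_monomials n" and m': "m' \<in> standard_monomials n"
      and y_eq: "y_degree n m = y_degree n m'"
      and xy: "\<And>i. 3 \<le> i \<Longrightarrow> Poly_Mapping.lookup m (i, 1) + Poly_Mapping.lookup m (i, 2)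
        = Poly_Mapping.lookup m' (i, 1) + Poly_Mapping.lookup m' (i, 2)" for i m m'
  proof (rule ccontr)
    assume gt: "\<not> ?thesis"
    have "\<exists>j\<in>{3..n}. Poly_Mapping.lookup m (j, 2) < Poly_Mapping.lookup m' (j, 2)"
    proof (rule ccontr)
      assume "\<not> ?thesis"
      then have "\<forall>j\<in>{3..n}. Poly_Mapping.lookup m' (j, 2) \<le> Poly_Mapping.lookup m (j, 2)"
        by (auto simp: not_less)
      moreover have "\<exists>j\<in>{3..n}. Poly_Mapping.lookup m' (j, 2) < Poly_Mapping.lookup m (j, 2)"
        using gt i by (intro bexI[of _ i]) auto
      ultimately have "y_degree n m' < y_degree n m"
        unfolding y_degree_def by (intro sum_strict_mono_ex1) auto
      with y_eq show False by simp
    qed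
    then obtain j where j: "3 \<le> j" "j \<le> n" "Poly_Mapping.lookup m (j, 2) < Poly_Mapping.lookup m' (j, 2)"
      by auto
    have "Poly_Mapping.lookup m' (i, 1) \<noteq> 0" "Poly_Mapping.lookup m' (j, 2) \<noteq> 0"
      using gt j xy[OF i(1)] by auto
    then have "\<not> i < j"
      using standard_x_y[OF m' i(1) _ j(2)] by metis
    moreover have "Poly_Mapping.lookup m (j, 1) \<noteq> 0" "Poly_Mapping.lookup m (i, 2) \<noteq> 0"
      using gt j xy[OF j(1)] by auto
    then have "\<not> j < i"
      using standard_x_y[OF m j(1) _ i(2)] by metis
    ultimately show False
      using gt j by (metis less_asym not_le linorder_neqE_nat)
  qed
  show ?thesis
  proof (rule poly_mapping_eqI, clarify)
    fix i j
    have outside: "Poly_Mapping.lookup m v = 0" "Poly_Mapping.lookup m' v = 0"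
      if "v \<notin> {1..n} \<times> {1..n}" for v
      using m m' that by (auto simp: standard_monomials_def monomials_def in_keys_iff simp del: mem_Sigma_iff)
    consider "(i, j) \<notin> {1..n} \<times> {1..n}" | "i = 1" "j = 1" | "3 \<le> i" "i \<le> n" "j = 1 \<or> j = 2" 
      | "\<not> (i = 1 \<and> j = 1)" "\<not> (3 \<le> i \<and> j = 1)" "\<not> (3 \<le> i \<and> j = 2)"
      by fastforce
    then show "Poly_Mapping.lookup m (i, j) = Poly_Mapping.lookup m' (i, j)"
    proof cases
      case 1
      then show ?thesis using outside by simp
    next
      case 2
      then show ?thesis using a_eq by simp
    next
      case 3
      have "Poly_Mapping.lookup m (i, 2) = Poly_Mapping.lookup m' (i, 2)"
        using le[OF 3(1,2) m m' y_eq xy] le[OF 3(1,2) m' m y_eq[symmetric] xy[symmetric]] by simp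
      then show ?thesis
        using xy[OF 3(1)] 3(3) by auto
    next
      case 4
      then show ?thesis
        using pe[of "(i, j)"] by (auto simp: lookup_param_exponent)
    qed
  qed
qed

text \<open>Choose \<mu> of maximal extremal weight in the support of \<open>f\<close> and read off
  the coefficient at its extremal exponent. Another term contributing there would have a different
  extremal exponent, hence one of larger weight. What remains is the coefficient of \<mu> up to
  sign.\<close>

lemma standard_independent:
  fixes f :: "'k::comm_ring_1 entry_poly"
  assumes std: "Poly_Mapping.keys f \<subseteq> standard_monomials n" and "param n f = 0"
  shows "f = 0"
proof (rule ccontr)
  assume "f \<noteq> 0"
  let ?w = "\<lambda>m. weight n (extremal_exponent n m)"
  have "Max (?w ` Poly_Mapping.keys f) \<in> ?w ` Poly_Mapping.keys f"
    using \<open>f \<noteq> 0\<close> by (intro Max_in) auto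
  then obtain \<mu> where \<mu>: "\<mu> \<in> Poly_Mapping.keys f" "Max (?w ` Poly_Mapping.keys f) = ?w \<mu>"
    by auto
  have max: "?w m \<le> ?w \<mu>" if "m \<in> Poly_Mapping.keys f" for m
    using that \<mu>(2)[symmetric] by simp
  let ?A = "\<lambda>m. param_a ^ Poly_Mapping.lookup m (1, 1) :: laurent_monomial \<Rightarrow>\<^sub>0 'k"
  let ?E = "extremal_exponent n \<mu>"
  have other: "Poly_Mapping.lookup (?A m) (?E - param_exponent n m) = 0"
    if m: "m \<in> Poly_Mapping.keys f" "m \<noteq> \<mu>" for m
  proof (rule ccontr)
    assume nz: "\<not> ?thesis"
    have "?E \<noteq> extremal_exponent n m"
      using extremal_exponent_inj m \<mu>(1) std by blast
    then have "?w \<mu> < ?w m"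
      using weight_less_extremal nz m(1) std by blast
    with max[OF m(1)] show False by simp
  qed
  have "0 = Poly_Mapping.lookup (param n f) ?E"
    using assms(2) by simp
  also have "\<dots> = (\<Sum>m\<in>Poly_Mapping.keys f.
      Poly_Mapping.lookup f m * Poly_Mapping.lookup (?A m) (?E - param_exponent n m))"
    by (simp add: param_def lookup_sum lookup_single_mult_diff)
  also have "\<dots> = (\<Sum>m\<in>{\<mu>}. Poly_Mapping.lookup f m * Poly_Mapping.lookup (?A m) (?E - param_exponent n m))"
    using \<mu>(1) other by (intro sum.mono_neutral_right) auto
  finally have "Poly_Mapping.lookup f \<mu> * Poly_Mapping.lookup (?A \<mu>) (?E - param_exponent n \<mu>) = 0"
    by simp
  moreover have "(- 1) ^ k = (1::'k) \<or> (- 1) ^ k = (- 1::'k)" for k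
    by (cases "even k") auto
  ultimately have "Poly_Mapping.lookup f \<mu> = 0"
    using lookup_extremal[of \<mu> n, where 'k='k] by (auto, metis mult_1_right mult_minus_right neg_equal_0_iff_equal)
  with \<mu>(1) show False
    by (simp add: in_keys_iff)
qed

section \<open>Reduction to standard monomials\<close>

definition mdegree :: "('a \<Rightarrow>\<^sub>0 nat) \<Rightarrow> nat" where
  "mdegree m = (\<Sum>v \<in> Poly_Mapping.keys m. Poly_Mapping.lookup m v)"

lemma mdegree_add: "mdegree (m + m') = mdegree m + mdegree m'"
  unfolding mdegree_def by (rule setsum_keys_plus_distrib) simp_all

lemma mdegree_0 [simp]: "mdegree 0 = 0"
  by (simp add: mdegree_def)

lemma mdegree_single [simp]: "mdegree (Poly_Mapping.single v e) = e"
  by (simp add: mdegree_def)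

lemma lookup_le_mdegree: "Poly_Mapping.lookup m v \<le> mdegree m"
proof (cases "v \<in> Poly_Mapping.keys m")
  case True
  then show ?thesis
    unfolding mdegree_def by (intro member_le_sum) auto
qed (simp add: in_keys_iff)

lemma finite_mdegree:
  assumes "finite V"
  shows "finite {m. Poly_Mapping.keys m \<subseteq> V \<and> mdegree m = d}" (is "finite ?M")
proof (rule finite_imageD)
  let ?f = "\<lambda>m. restrict (Poly_Mapping.lookup m) V"
  have "?f ` ?M \<subseteq> V \<rightarrow>\<^sub>E {..d}"
    by (auto simp: lookup_le_mdegree)
  then show "finite (?f ` ?M)"
    by (rule finite_subset) (simp add: assms finite_PiE)
  show "inj_on ?f ?M"
  proof (rule inj_onI, rule poly_mapping_eqI)
    fix m m' v
    assume m: "m \<in> ?M" "m' \<in> ?M" and eq: "?f m = ?f m'"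
    show "Poly_Mapping.lookup m v = Poly_Mapping.lookup m' v"
    proof (cases "v \<in> V")
      case True
      then show ?thesis using fun_cong[OF eq, of v] by simp
    next
      case False
      then have "v \<notin> Poly_Mapping.keys m" "v \<notin> Poly_Mapping.keys m'"
        using m by auto
      then show ?thesis by (simp add: in_keys_iff)
    qed
  qed
qed

lemma add_in_monomials: "m \<in> monomials n \<Longrightarrow> m' \<in> monomials n \<Longrightarrow> m + m' \<in> monomials n"
  using Poly_Mapping.keys_add[of m m'] unfolding monomials_def by blast

lemma monomials_addD:
  assumes "m + m' \<in> monomials n"
  shows "m \<in> monomials n" "m' \<in> monomials n"
  using assms by (auto simp: monomials_def in_keys_iff lookup_add subset_iff)

lemma standard_subset_monomials: "standard_monomials n \<subseteq> monomials n"
  by (auto simp: standard_monomials_def)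

lemma entry_ring_ops [simp]:
  "p \<otimes>\<^bsub>entry_ring n\<^esub> q = p * q" "p \<oplus>\<^bsub>entry_ring n\<^esub> q = p + q"
  "\<one>\<^bsub>entry_ring n\<^esub> = 1" "\<zero>\<^bsub>entry_ring n\<^esub> = 0"
  by (simp_all add: entry_ring_def)

lemma carrier_entry_ring: "p \<in> carrier (entry_ring n) \<longleftrightarrow> Poly_Mapping.keys p \<subseteq> monomials n"
  by (auto simp: entry_ring_def monomials_def)

lemma ring_entry_ring: "ring (entry_ring n :: 'k::comm_ring_1 entry_poly ring)"
  using cring_entry_ring cring.axioms(1) by blast

lemma carrier_entry_ring_closed:
  fixes p q :: "'k::comm_ring_1 entry_poly"
  assumes "p \<in> carrier (entry_ring n)" "q \<in> carrier (entry_ring n)"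
  shows "p + q \<in> carrier (entry_ring n)" "p - q \<in> carrier (entry_ring n)"
    "p * q \<in> carrier (entry_ring n)" "- p \<in> carrier (entry_ring n)"
proof -
  interpret cring "entry_ring n :: 'k entry_poly ring"
    by (rule cring_entry_ring)
  show add: "p + q \<in> carrier (entry_ring n)" and mult: "p * q \<in> carrier (entry_ring n)"
    using add.m_closed[OF assms] m_closed[OF assms] by simp_all
  show "- p \<in> carrier (entry_ring n)"
    using assms by (simp add: carrier_entry_ring)
  show "p - q \<in> carrier (entry_ring n)"
    using assms keys_diff[of p q] by (auto simp: carrier_entry_ring)
qed

lemma a_inv_entry_ring:
  assumes "p \<in> carrier (entry_ring n :: 'k::comm_ring_1 entry_poly ring)"
  shows "\<ominus>\<^bsub>entry_ring n\<^esub> p = - p"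
proof -
  interpret cring "entry_ring n :: 'k entry_poly ring"
    by (rule cring_entry_ring)
  show ?thesis
    using assms carrier_entry_ring_closed[OF assms assms] by (intro minus_equality) auto
qed

lemma single_in_carrier:
  "m \<in> monomials n \<Longrightarrow> Poly_Mapping.single m c \<in> carrier (entry_ring n)"
  by (simp add: carrier_entry_ring)

lemma ideal_entry_ringI:
  fixes I :: "'k::comm_ring_1 entry_poly set"
  assumes sub: "I \<subseteq> carrier (entry_ring n)" and zero: "0 \<in> I"
    and add: "\<And>p q. p \<in> I \<Longrightarrow> q \<in> I \<Longrightarrow> p + q \<in> I"
    and mult: "\<And>r p. r \<in> carrier (entry_ring n) \<Longrightarrow> p \<in> I \<Longrightarrow> r * p \<in> I"
  shows "ideal I (entry_ring n)"
proof (rule idealI)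
  show "ring (entry_ring n :: 'k entry_poly ring)"
    by (rule ring_entry_ring)
  interpret cring "entry_ring n :: 'k entry_poly ring"
    by (rule cring_entry_ring)
  have "\<ominus>\<^bsub>entry_ring n\<^esub> p \<in> I" if "p \<in> I" for p
  proof -
    have "- 1 \<in> carrier (entry_ring n :: 'k entry_poly ring)"
      using carrier_entry_ring_closed(4)[OF one_closed one_closed] by simp
    from mult[OF this that] show ?thesis
      using a_inv_entry_ring[of p n] that sub by auto
  qed
  then show "subgroup I (add_monoid (entry_ring n))"
    using sub zero add
    by (intro add.subgroupI) (auto simp: a_inv_def[symmetric] subset_iff)
  show "x \<otimes>\<^bsub>entry_ring n\<^esub> p \<in> I" "p \<otimes>\<^bsub>entry_ring n\<^esub> x \<in> I" if "p \<in> I" "x \<in> carrier (entry_ring n)" for p x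
    using mult[OF that(2,1)] by (simp_all add: mult.commute)
qed

lemma ideal_entry_ringD:
  fixes I :: "'k::comm_ring_1 entry_poly set"
  assumes "ideal I (entry_ring n)"
  shows "I \<subseteq> carrier (entry_ring n)" "0 \<in> I" "p \<in> I \<Longrightarrow> q \<in> I \<Longrightarrow> p + q \<in> I"
    "r \<in> carrier (entry_ring n) \<Longrightarrow> p \<in> I \<Longrightarrow> r * p \<in> I" "p \<in> I \<Longrightarrow> q \<in> I \<Longrightarrow> p - q \<in> I"
    "(\<And>a. a \<in> A \<Longrightarrow> f a \<in> I) \<Longrightarrow> sum f A \<in> I"
proof -
  interpret ideal I "entry_ring n" by fact
  show sub: "I \<subseteq> carrier (entry_ring n)" and zero: "0 \<in> I"
    using additive_subgroup.zero_closed[of I "entry_ring n"] additive_subgroup_axioms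
    by (auto simp: a_subset[THEN subsetD])
  show add: "p + q \<in> I" if "p \<in> I" "q \<in> I" for p q
    using additive_subgroup.a_closed[OF additive_subgroup_axioms that] by simp
  show mult: "r \<in> carrier (entry_ring n) \<Longrightarrow> p \<in> I \<Longrightarrow> r * p \<in> I" for r p
    using I_l_closed[of p r] by simp
  show "p - q \<in> I" if "p \<in> I" "q \<in> I"
  proof -
    have "- q \<in> I"
      using additive_subgroup.a_inv_closed[OF additive_subgroup_axioms that(2)] a_inv_entry_ring[of q n] that(2) sub by auto
    from add[OF that(1) this] show ?thesis by simp
  qed
  show "sum f A \<in> I" if "\<And>a. a \<in> A \<Longrightarrow> f a \<in> I"
    using that by (induction A rule: infinite_finite_induct) (auto simp: zero add)
qed

text \<open>Extends a reduction of single monomials linearly. The relation \<open>P\<close> traces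
  every term of the remainder back to a term of \<open>f\<close>, so that bounds on order and degree
  carry over.\<close>

lemma reduce_linear:
  fixes I :: "'k::comm_ring_1 entry_poly set"
  assumes I: "ideal I (entry_ring n)"
    and red: "\<And>m. m \<in> Poly_Mapping.keys f \<Longrightarrow>
      \<exists>r. Poly_Mapping.single m 1 - r \<in> I \<and> (\<forall>\<mu>\<in>Poly_Mapping.keys r. P m \<mu>)"
  shows "\<exists>r. f - r \<in> I \<and> (\<forall>\<mu>\<in>Poly_Mapping.keys r. \<exists>m\<in>Poly_Mapping.keys f. P m \<mu>)"
proof -
  note idl = ideal_entry_ringD[OF I]
  obtain r where r: "\<And>m. m \<in> Poly_Mapping.keys f \<Longrightarrow> Poly_Mapping.single m 1 - r m \<in> I"
    "\<And>m \<mu>. m \<in> Poly_Mapping.keys f \<Longrightarrow> \<mu> \<in> Poly_Mapping.keys (r m) \<Longrightarrow> P m \<mu>"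
    using bchoice[of "Poly_Mapping.keys f" "\<lambda>m r. Poly_Mapping.single m 1 - r \<in> I \<and>
      (\<forall>\<mu>\<in>Poly_Mapping.keys r. P m \<mu>)"] red by blast
  let ?c = "\<lambda>m. Poly_Mapping.single 0 (Poly_Mapping.lookup f m)"
  define R where "R = (\<Sum>m\<in>Poly_Mapping.keys f. ?c m * r m)"
  have const: "?c m \<in> carrier (entry_ring n)" for m
    by (rule single_in_carrier) (simp add: monomials_def)
  have "f - R = (\<Sum>m\<in>Poly_Mapping.keys f. ?c m * (Poly_Mapping.single m 1 - r m))"
    using sum_single_keys[of f] by (simp add: R_def sum_subtractf right_diff_distrib mult_single)
  moreover have "(\<Sum>m\<in>Poly_Mapping.keys f. ?c m * (Poly_Mapping.single m 1 - r m)) \<in> I"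
    by (rule idl(6), rule idl(4)) (rule const r(1), assumption?)+
  ultimately have "f - R \<in> I"
    by simp
  moreover have "\<exists>m\<in>Poly_Mapping.keys f. P m \<mu>" if \<mu>: "\<mu> \<in> Poly_Mapping.keys R" for \<mu>
  proof -
    obtain m where m: "m \<in> Poly_Mapping.keys f" "\<mu> \<in> Poly_Mapping.keys (?c m * r m)"
      using \<mu> keys_sum[of "\<lambda>m. ?c m * r m" "Poly_Mapping.keys f"] unfolding R_def by blast
    then have "\<mu> \<in> Poly_Mapping.keys (r m)"
      using keys_single_mult[of 0 "Poly_Mapping.lookup f m" "r m"] by auto
    then show ?thesis
      using r(2) m(1) by blast
  qed
  ultimately show ?thesis by blast
qed

text \<open>Division with monic divisors: subtracting \<kappa> times \<open>g\<close> cancels \<nu>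
  and leaves only smaller monomials of the same degree, which are reduced recursively.\<close>

lemma reduce_monomial:
  fixes I G :: "'k::comm_ring_1 entry_poly set"
  assumes I: "ideal I (entry_ring n)" and GI: "G \<subseteq> I"
    and red: "\<And>\<nu>. \<nu> \<in> monomials n \<Longrightarrow> \<nu> \<notin> S \<Longrightarrow> \<exists>g\<in>G. \<exists>\<kappa> l. \<nu> = \<kappa> + l \<and> Poly_Mapping.lookup g l = 1 \<and>
      (\<forall>m\<in>Poly_Mapping.keys g. m \<le> l \<and> mdegree m = mdegree l)"
    and "\<nu> \<in> monomials n"
  shows "\<exists>r. Poly_Mapping.single \<nu> 1 - r \<in> I \<and>
    (\<forall>\<mu>\<in>Poly_Mapping.keys r. \<mu> \<in> S \<inter> monomials n \<and> \<mu> \<le> \<nu> \<and> mdegree \<mu> = mdegree \<nu>)"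
  using assms(4)
\<comment> \<open>In the lexicographic order infinitely many monomials can lie below \<nu>, for
  instance all powers of a smaller variable. Since the degree is preserved, counting those of equal
  degree gives a finite measure.\<close>
proof (induction "card {\<mu>\<in>monomials n. mdegree \<mu> = mdegree \<nu> \<and> \<mu> < \<nu>}" arbitrary: \<nu> rule: less_induct)
  case less
  note idl = ideal_entry_ringD[OF I]
  show ?case
  proof (cases "\<nu> \<in> S")
    case True
    with less.prems show ?thesis
      by (intro exI[of _ "Poly_Mapping.single \<nu> 1"]) (simp add: idl(2))
  next
    case False
    then obtain g \<kappa> l where g: "g \<in> G" "\<nu> = \<kappa> + l" "Poly_Mapping.lookup g l = 1"
      "\<And>m. m \<in> Poly_Mapping.keys g \<Longrightarrow> m \<le> l \<and> mdegree m = mdegree l"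
      using red[OF less.prems] by meson
    define q where "q = Poly_Mapping.single \<nu> 1 - Poly_Mapping.single \<kappa> 1 * g"
    have "g \<in> carrier (entry_ring n)"
      using g(1) GI idl(1) by auto
    have q: "\<mu> \<in> monomials n \<and> \<mu> < \<nu> \<and> mdegree \<mu> = mdegree \<nu>" if \<mu>: "\<mu> \<in> Poly_Mapping.keys q" for \<mu>
    proof -
      have "Poly_Mapping.lookup q \<nu> = 0"
        using g(2,3) by (simp add: q_def lookup_minus lookup_single_mult_add)
      then have "\<mu> \<noteq> \<nu>"
        using that by (auto simp: in_keys_iff)
      moreover have "Poly_Mapping.keys q \<subseteq> insert \<nu> ((+) \<kappa> ` Poly_Mapping.keys g)"
        unfolding q_def using keys_diff[of "Poly_Mapping.single \<nu> 1" "Poly_Mapping.single \<kappa> 1 * g"]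
          keys_single_mult[of \<kappa> 1 g] by (auto split: if_splits)
      ultimately obtain m where m: "m \<in> Poly_Mapping.keys g" "\<mu> = \<kappa> + m"
        using \<mu> by blast
      have "\<kappa> \<in> monomials n"
        using g(2) monomials_addD(1) less.prems by simp
      moreover have "m \<in> monomials n"
        using \<open>g \<in> carrier (entry_ring n)\<close> m(1) by (auto simp: carrier_entry_ring)
      moreover have "\<mu> \<le> \<nu>"
        unfolding m(2) g(2) using g(4)[OF m(1)] by (simp only: add_left_mono)
      ultimately show ?thesis
        using g(4)[OF m(1)] \<open>\<mu> \<noteq> \<nu>\<close> unfolding order_less_le
        by (simp only: m(2) g(2) mdegree_add add_in_monomials simp_thms)
    qed
    have "\<exists>r. Poly_Mapping.single \<mu> 1 - r \<in> I \<and>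
      (\<forall>\<rho>\<in>Poly_Mapping.keys r. \<rho> \<in> S \<inter> monomials n \<and> \<rho> \<le> \<mu> \<and> mdegree \<rho> = mdegree \<mu>)"
      if "\<mu> \<in> Poly_Mapping.keys q" for \<mu>
    proof (rule less.hyps)
      have "finite {\<mu>\<in>monomials n. mdegree \<mu> = mdegree \<nu> \<and> \<mu> < \<nu>}"
        by (rule finite_subset[OF _ finite_mdegree[of "{1..n} \<times> {1..n}" "mdegree \<nu>"]])
          (auto simp: monomials_def)
      then show "card {\<rho>\<in>monomials n. mdegree \<rho> = mdegree \<mu> \<and> \<rho> < \<mu>}
          < card {\<mu>\<in>monomials n. mdegree \<mu> = mdegree \<nu> \<and> \<mu> < \<nu>}"
        using q[OF that] by (intro psubset_card_mono) auto
    qed (use q[OF that] in simp)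
    then obtain R where R: "q - R \<in> I" "\<forall>\<rho>\<in>Poly_Mapping.keys R. \<exists>\<mu>\<in>Poly_Mapping.keys q.
        \<rho> \<in> S \<inter> monomials n \<and> \<rho> \<le> \<mu> \<and> mdegree \<rho> = mdegree \<mu>"
      using reduce_linear[OF I, of q "\<lambda>\<mu> \<rho>. \<rho> \<in> S \<inter> monomials n \<and> \<rho> \<le> \<mu> \<and> mdegree \<rho> = mdegree \<mu>"]
      by blast
    have "\<kappa> \<in> monomials n"
      using g(2) monomials_addD(1) less.prems by simp
    then have "Poly_Mapping.single \<kappa> 1 * g \<in> I"
      using g(1) GI by (intro idl(4) single_in_carrier subsetD[OF GI])
    from idl(3)[OF R(1) this] have "Poly_Mapping.single \<nu> 1 - R \<in> I"
      by (simp add: q_def)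
    moreover have "\<rho> \<in> S \<inter> monomials n \<and> \<rho> \<le> \<nu> \<and> mdegree \<rho> = mdegree \<nu>"
      if \<rho>: "\<rho> \<in> Poly_Mapping.keys R" for \<rho>
      using R(2) \<rho> q by fastforce
    ultimately show ?thesis by blast
  qed
qed

section \<open>The ideal of minors as the kernel of the parametrization\<close>

abbreviation var :: "nat \<Rightarrow> nat \<Rightarrow> monomial" where
  "var i j \<equiv> Poly_Mapping.single (i, j) 1"

section \<open>Leading terms of the quadrics and cubics\<close>

lemma quadric_eq:
  "quadric i j = Poly_Mapping.single (var i 1 + var j 2) 1 - Poly_Mapping.single (var i 2 + var j 1) 1"
  by (simp add: quadric_def entry_def mult_single)

lemma cubic_eq:
  "cubic i j = Poly_Mapping.single (var 1 1 + var i 2 + var j 1) 1 - Poly_Mapping.single (var 1 2 + var i 1 + var j 1) 1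
     + Poly_Mapping.single (var 2 1 + var i 2 + var j 2) 1 - Poly_Mapping.single (var 2 2 + var i 1 + var j 2) 1"
  by (simp add: cubic_def entry_def mult_single)

lemma var_less_quadric:
  assumes "i < j"
  shows "var i 2 + var j 1 < var i 1 + var j 2"
  unfolding less_monomial_iff
  by (rule exI[of _ i], rule exI[of _ 1]) (use assms in \<open>auto simp: lookup_add lookup_single when_def\<close>)

text \<open>The type also has variables with index 0, and (0, j) and (1, 0) precede (1, 1). Only
  when they are absent is a the first variable to be compared.\<close>

lemma less_monomial_if_less_a:
  fixes m m' :: monomial
  assumes "Poly_Mapping.lookup m (1, 1) < Poly_Mapping.lookup m' (1, 1)"
    and "\<And>i j. i = 0 \<or> j = 0 \<Longrightarrow> Poly_Mapping.lookup m (i, j) = 0"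
    and "\<And>i j. i = 0 \<or> j = 0 \<Longrightarrow> Poly_Mapping.lookup m' (i, j) = 0"
  shows "m < m'"
  unfolding less_monomial_iff
  by (rule exI[of _ 1], rule exI[of _ 1]) (use assms in simp)

lemma var_less_cubic:
  assumes "3 \<le> i" "3 \<le> j"
  shows "var 1 2 + var i 1 + var j 1 < var 1 1 + var i 2 + var j 1"
    "var 2 1 + var i 2 + var j 2 < var 1 1 + var i 2 + var j 1"
    "var 2 2 + var i 1 + var j 2 < var 1 1 + var i 2 + var j 1"
  by (rule less_monomial_if_less_a;
      use assms in \<open>simp add: lookup_add lookup_single; fastforce simp: when_def\<close>)+

lemma keys_quadric:
  "Poly_Mapping.keys (quadric i j :: 'k::comm_ring_1 entry_poly) \<subseteq> {var i 1 + var j 2, var i 2 + var j 1}"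
  unfolding quadric_eq using keys_diff by (fastforce split: if_splits)

lemma keys_cubic:
  "Poly_Mapping.keys (cubic i j :: 'k::comm_ring_1 entry_poly) \<subseteq>
    {var 1 1 + var i 2 + var j 1, var 1 2 + var i 1 + var j 1,
     var 2 1 + var i 2 + var j 2, var 2 2 + var i 1 + var j 2}"
proof
  fix m
  assume "m \<in> Poly_Mapping.keys (cubic i j :: 'k entry_poly)"
  then show "m \<in> {var 1 1 + var i 2 + var j 1, var 1 2 + var i 1 + var j 1,
     var 2 1 + var i 2 + var j 2, var 2 2 + var i 1 + var j 2}"
    by (simp add: in_keys_iff cubic_eq lookup_add lookup_minus lookup_single when_def split: if_splits)
qed

lemma lookup_quadric_lead:
  assumes "i < j"
  shows "Poly_Mapping.lookup (quadric i j :: 'k::comm_ring_1 entry_poly) (var i 1 + var j 2) = 1"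
  using var_less_quadric[OF assms] by (simp add: quadric_eq lookup_minus lookup_single when_def)

lemma lookup_cubic_lead:
  assumes "3 \<le> i" "3 \<le> j"
  shows "Poly_Mapping.lookup (cubic i j :: 'k::comm_ring_1 entry_poly) (var 1 1 + var i 2 + var j 1) = 1"
  unfolding cubic_eq lookup_add lookup_minus lookup_single
  using var_less_cubic[OF assms, THEN less_imp_neq] by (simp only: when_def if_False refl if_True) simp

lemma leading_term_eq:
  fixes p :: "'k::comm_ring_1 entry_poly"
  assumes "Poly_Mapping.lookup p l = 1" "\<And>m. m \<in> Poly_Mapping.keys p \<Longrightarrow> m \<le> l"
  shows "leading_term p = Poly_Mapping.single l 1"
proof -
  have "Max (Poly_Mapping.keys p) = l"
    using assms by (intro Max_eqI) (auto simp: in_keys_iff)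
  with assms show ?thesis
    by (simp add: leading_term_def)
qed

lemma keys_quadric_le:
  assumes "i < j" "m \<in> Poly_Mapping.keys (quadric i j :: 'k::comm_ring_1 entry_poly)"
  shows "m \<le> var i 1 + var j 2"
  using keys_quadric[of i j, where 'k='k] assms var_less_quadric[OF assms(1)] by (auto intro: less_imp_le)

lemma keys_cubic_le:
  assumes "3 \<le> i" "3 \<le> j" "m \<in> Poly_Mapping.keys (cubic i j :: 'k::comm_ring_1 entry_poly)"
  shows "m \<le> var 1 1 + var i 2 + var j 1"
  using keys_cubic[of i j, where 'k='k] assms(3) var_less_cubic[OF assms(1,2)]
  by (elim subsetD[elim_format] insertE emptyE) (auto intro: less_imp_le simp del: One_nat_def)

lemma leading_term_quadric:
  "i < j \<Longrightarrow> leading_term (quadric i j :: 'k::comm_ring_1 entry_poly) = Poly_Mapping.single (var i 1 + var j 2) 1"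
  by (intro leading_term_eq lookup_quadric_lead keys_quadric_le)

lemma leading_term_cubic:
  "3 \<le> i \<Longrightarrow> 3 \<le> j \<Longrightarrow> leading_term (cubic i j :: 'k::comm_ring_1 entry_poly)
    = Poly_Mapping.single (var 1 1 + var i 2 + var j 1) 1"
  by (intro leading_term_eq lookup_cubic_lead keys_cubic_le)

lemma entry_in_carrier:
  "i \<in> {1..n} \<Longrightarrow> j \<in> {1..n} \<Longrightarrow> entry i j \<in> carrier (entry_ring n)"
  unfolding entry_def by (rule single_in_carrier) (simp add: monomials_def)

lemma quadric_in_carrier:
  assumes "3 \<le> i" "i \<le> n" "3 \<le> j" "j \<le> n"
  shows "(quadric i j :: 'k::comm_ring_1 entry_poly) \<in> carrier (entry_ring n)"
  unfolding quadric_def by (intro carrier_entry_ring_closed entry_in_carrier) (use assms in auto)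

lemma cubic_in_carrier:
  assumes "3 \<le> i" "i \<le> n" "3 \<le> j" "j \<le> n"
  shows "(cubic i j :: 'k::comm_ring_1 entry_poly) \<in> carrier (entry_ring n)"
  unfolding cubic_def by (intro carrier_entry_ring_closed entry_in_carrier) (use assms in auto)

section \<open>The kernel is prime and contains the minors\<close>

definition param_kernel :: "nat \<Rightarrow> 'k::comm_ring_1 entry_poly set" where
  "param_kernel n = {p \<in> carrier (entry_ring n). param n p = 0}"

lemma ideal_param_kernel: "ideal (param_kernel n :: 'k::comm_ring_1 entry_poly set) (entry_ring n)"
  by (rule ideal_entry_ringI)
    (auto simp: param_kernel_def param_add param_mult carrier_entry_ring_closed, simp add: carrier_entry_ring)

text \<open>Laurent exponents are linearly ordered compatibly with addition, so the product of two
  nonzero Laurent polynomials over a field is nonzero. If \<open>p * q\<close> is in the kernel, one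
  of the images therefore vanishes.\<close>

lemma primeideal_param_kernel: "primeideal (param_kernel n :: 'k::field entry_poly set) (entry_ring n)"
proof (rule primeidealI)
  have "1 \<in> carrier (entry_ring n :: 'k entry_poly ring)"
    by (simp add: carrier_entry_ring monomials_def)
  moreover have "1 \<notin> (param_kernel n :: 'k entry_poly set)"
    by (simp add: param_kernel_def)
  ultimately show "carrier (entry_ring n) \<noteq> (param_kernel n :: 'k entry_poly set)"
    by blast
qed (auto simp: param_kernel_def param_mult ideal_param_kernel[unfolded param_kernel_def] cring_entry_ring)

abbreviation tvar :: "laurent_monomial \<Rightarrow>\<^sub>0 'k::comm_ring_1" where
  "tvar \<equiv> Poly_Mapping.single (Poly_Mapping.single (1, 1) 1) 1"

lemma param_entry:
  "param n (entry i j) = Poly_Mapping.single (param_exponent n (var i j)) 1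
     * param_a ^ (if i = 1 \<and> j = 1 then 1 else 0)"
  by (simp add: entry_def param_single lookup_single when_def)

lemma param_entry_row:
  assumes "3 \<le> i" "i \<le> n"
  shows "param n (entry i 2) = tvar * param n (entry i 1)"
proof -
  have "param_exponent n (var i 2) = Poly_Mapping.single (1, 1) 1 + param_exponent n (var i 1)"
  proof (rule poly_mapping_eqI, clarify)
    fix k l :: nat
    consider "k = 1" "l = 1" | "3 \<le> k" "l = 1 \<or> l = 2" | "\<not> (k = 1 \<and> l = 1)" "\<not> (3 \<le> k \<and> (l = 1 \<or> l = 2))"
      by blast
    then show "Poly_Mapping.lookup (param_exponent n (var i 2)) (k, l) =
        Poly_Mapping.lookup (Poly_Mapping.single (1, 1) 1 + param_exponent n (var i 1)) (k, l)"
      using assms by cases (auto simp: lookup_param_exponent lookup_add lookup_single when_def if_distrib[of int] cong: if_cong)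
  qed
  then show ?thesis
    using assms by (simp add: param_entry mult_single)
qed

text \<open>Together with \<open>param_entry_row\<close> this makes the second column of A21 A11,
  and not only that of A21, equal to t times the first.\<close>

lemma param_entry_eigenvector:
  "tvar * (param n (entry 1 1) + tvar * param n (entry 2 1)) = param n (entry 1 2) + tvar * param n (entry 2 2)"
proof -
  have eq: "param_exponent n (var 1 1) = 0" 
    "param_exponent n (var 2 1) = Poly_Mapping.single (2, 1) 1"
    "param_exponent n (var 1 2) = Poly_Mapping.single (1, 2) 1"
    "param_exponent n (var 2 2) = Poly_Mapping.single (2, 2) 1"
    by ((intro poly_mapping_eqI, clarify, auto simp: lookup_param_exponent lookup_add lookup_single when_def)[])+
  show ?thesis
    unfolding param_entry eq
    by (simp add: param_a_def distrib_left right_diff_distrib mult_single exp_b_over_t_def exp_ct_def exp_d_def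
        add.commute add.left_commute)
qed

lemma kalman_dims:
  "dim_row (reduced_kalman_matrix (generic_matrix n)) = (n - 2) + (n - 2)"
  "dim_col (reduced_kalman_matrix (generic_matrix n)) = 2"
  by (simp_all add: reduced_kalman_matrix_def split_block_def Let_def append_rows_def generic_matrix_def)

text \<open>Row r of A21, counted from 0, is row r + 3 of the generic matrix, counted from 1. The
  rows from n - 2 on belong to A21 A11.\<close>

lemma kalman_index:
  assumes "2 \<le> n" "r < (n - 2) + (n - 2)" "c < 2"
  shows "reduced_kalman_matrix (generic_matrix n) $$ (r, c) = (if r < n - 2 then entry (r + 3) (c + 1)
    else entry (r - (n - 2) + 3) 1 * entry 1 (c + 1) + entry (r - (n - 2) + 3) 2 * entry 2 (c + 1))"
  using assms
  by (auto simp: reduced_kalman_matrix_def split_block_def Let_def append_rows_def generic_matrix_def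
      scalar_prod_def numeral_eq_Suc)

lemma det_2_2:
  assumes "A \<in> carrier_mat 2 2"
  shows "Determinant.det A = A $$ (0, 0) * A $$ (1, 1) - A $$ (0, 1) * A $$ (1, 0)"
proof -
  have "Determinant.det (mat_delete A 0 0) = A $$ (1, 1)"
    using assms by (subst det_single) (auto simp: mat_delete_def)
  moreover have "Determinant.det (mat_delete A 0 1) = A $$ (1, 0)"
    using assms by (subst det_single) (auto simp: mat_delete_def)
  ultimately show ?thesis
    using assms by (subst laplace_expansion_row[OF assms, of 0])
      (auto simp: numeral_2_eq_2 cofactor_def)
qed

lemma pick_pair:
  assumes "r < s"
  shows "pick {r, s} 0 = r" "pick {r, s} 1 = s"
proof -
  show "pick {r, s} 0 = r"
    using assms by (auto intro!: Least_equality)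
  then show "pick {r, s} 1 = s"
    using assms by (auto intro!: Least_equality)
qed

lemma minors_2_two_columns:
  assumes "dim_col M = 2"
  shows "minors 2 M = {M $$ (r, 0) * M $$ (s, 1) - M $$ (r, 1) * M $$ (s, 0) | r s. r < s \<and> s < dim_row M}"
proof -
  have det: "Determinant.det (submatrix M {r, s} {0, 1}) = M $$ (r, 0) * M $$ (s, 1) - M $$ (r, 1) * M $$ (s, 0)"
    if "r < s" "s < dim_row M" for r s
  proof -
    have I: "{i. i < dim_row M \<and> i \<in> {r, s}} = {r, s}" and J: "{j. j < dim_col M \<and> j \<in> {0, 1}} = {0, 1}"
      using that assms by auto
    have "submatrix M {r, s} {0, 1} $$ (i, j) = M $$ (pick {r, s} i, pick {0, 1} j)" if "i < 2" "j < 2" for i j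
      unfolding submatrix_def I J using \<open>r < s\<close> that by simp
    then show ?thesis
      using pick_pair[OF \<open>r < s\<close>] pick_pair[of 0 1] \<open>r < s\<close>
      by (subst det_2_2, unfold submatrix_def I J) (auto simp del: pick.simps)
  qed
  have rows: "\<exists>r s. I = {r, s} \<and> r < s" if "card I = 2" for I :: "nat set"
    using that by (auto simp: card_2_iff neq_iff)
  have cols: "J = {0, 1}" if "J \<subseteq> {..<2::nat}" "card J = 2" for J
    using card_subset_eq[OF _ that(1)] that(2) by (auto simp: lessThan_Suc numeral_2_eq_2)
  show ?thesis
  proof (intro equalityI subsetI)
    fix p
    assume "p \<in> minors 2 M"
    then obtain I J where IJ: "p = Determinant.det (submatrix M I J)" "I \<subseteq> {..<dim_row M}"
      "J \<subseteq> {..<2}" "card I = 2" "card J = 2"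
      by (auto simp: minors_def assms)
    then obtain r s where "I = {r, s}" "r < s"
      using rows by blast
    with IJ det[of r s] cols[OF IJ(3,5)]
    show "p \<in> {M $$ (r, 0) * M $$ (s, 1) - M $$ (r, 1) * M $$ (s, 0) | r s. r < s \<and> s < dim_row M}"
      by auto
  next
    fix p
    assume "p \<in> {M $$ (r, 0) * M $$ (s, 1) - M $$ (r, 1) * M $$ (s, 0) | r s. r < s \<and> s < dim_row M}"
    then obtain r s where "p = Determinant.det (submatrix M {r, s} {0, 1})" "r < s" "s < dim_row M"
      using det by auto
    then show "p \<in> minors 2 M"
      unfolding minors_def using assms
      by (intro CollectI exI[of _ "{r, s}"] exI[of _ "{0, 1}"]) auto
  qed
qed

text \<open>Every row of the Kalman matrix maps to a multiple of (1, t), so any two of them are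
  proportional.\<close>

lemma minors_kalman_subset_kernel:
  assumes "3 \<le> n"
  shows "minors 2 (reduced_kalman_matrix (generic_matrix n)) \<subseteq> (param_kernel n :: 'k::comm_ring_1 entry_poly set)"
proof
  let ?M = "reduced_kalman_matrix (generic_matrix n) :: 'k entry_poly mat"
  have row: "param n (?M $$ (r, 1)) = tvar * param n (?M $$ (r, 0))" if "r < (n - 2) + (n - 2)" for r
  proof (cases "r < n - 2")
    case True
    then have "r + 3 \<le> n"
      using assms by simp
    then show ?thesis
      using that True assms param_entry_row[of "r + 3" n] by (simp add: kalman_index numeral_2_eq_2[symmetric])
  next
    case False
    define i where "i = r - (n - 2) + 3"
    have i: "3 \<le> i" "i \<le> n"
      using False that by (auto simp: i_def)
    have idx: "?M $$ (r, 0) = entry i 1 * entry 1 1 + entry i 2 * entry 2 1"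
      "?M $$ (r, 1) = entry i 1 * entry 1 2 + entry i 2 * entry 2 2"
      unfolding i_def using False that assms
      by (subst kalman_index; simp add: numeral_2_eq_2[symmetric])+
    have "param n (?M $$ (r, 1)) = param n (entry i 1) * (param n (entry 1 2) + tvar * param n (entry 2 2))"
      unfolding idx param_add param_mult
      by (simp add: param_entry_row[OF i, simplified] algebra_simps)
    also have "\<dots> = tvar * (param n (entry i 1) * (param n (entry 1 1) + tvar * param n (entry 2 1)))"
      by (simp only: param_entry_eigenvector[symmetric] ac_simps)
    also have "\<dots> = tvar * param n (?M $$ (r, 0))"
      unfolding idx param_add param_mult
      by (simp add: param_entry_row[OF i, simplified] algebra_simps)
    finally show ?thesis .
  qed
  have carr: "?M $$ (r, c) \<in> carrier (entry_ring n)" if "r < (n - 2) + (n - 2)" "c < 2" for r c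
  proof (cases "r < n - 2")
    case True
    with that assms show ?thesis
      by (auto simp: kalman_index intro!: entry_in_carrier)
  next
    case False
    with that assms show ?thesis
      by (auto simp: kalman_index intro!: entry_in_carrier carrier_entry_ring_closed)
  qed
  fix p
  assume "p \<in> minors 2 ?M"
  then obtain r s where rs: "r < s" "s < (n - 2) + (n - 2)"
    "p = ?M $$ (r, 0) * ?M $$ (s, 1) - ?M $$ (r, 1) * ?M $$ (s, 0)"
    unfolding minors_2_two_columns[OF kalman_dims(2)] kalman_dims by blast
  have "p \<in> carrier (entry_ring n)"
    unfolding rs(3) using rs(1,2) by (intro carrier_entry_ring_closed carr) auto
  moreover have "param n p = 0"
    using rs(1,2) row[of r] row[of s] unfolding rs(3) param_diff param_mult by (simp add: ac_simps)
  ultimately show "p \<in> param_kernel n"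
    by (simp add: param_kernel_def)
qed

lemma kalman_ideal_subset_kernel:
  assumes "3 \<le> n"
  shows "kalman_ideal n \<subseteq> (param_kernel n :: 'k::comm_ring_1 entry_poly set)"
  unfolding kalman_ideal_def
  by (rule ring.genideal_minimal[OF ring_entry_ring ideal_param_kernel minors_kalman_subset_kernel[OF assms]])

lemma ideal_kalman:
  assumes "3 \<le> n"
  shows "ideal (kalman_ideal n :: 'k::comm_ring_1 entry_poly set) (entry_ring n)"
  unfolding kalman_ideal_def using minors_kalman_subset_kernel[OF assms, where 'k='k]
  by (intro ring.genideal_ideal[OF ring_entry_ring]) (auto simp: param_kernel_def)

text \<open>A quadric is a minor of two rows of A21. A cubic is, up to sign, the minor of row i of
  A21 and row j of A21 A11.\<close>

lemma generators_subset_kalman: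
  assumes "3 \<le> n"
  shows "quadrics n \<union> cubics n \<subseteq> (kalman_ideal n :: 'k::comm_ring_1 entry_poly set)"
proof -
  let ?M = "reduced_kalman_matrix (generic_matrix n) :: 'k entry_poly mat"
  note idl = ideal_entry_ringD[OF ideal_kalman[OF assms, where 'k='k]]
  have minor: "?M $$ (r, 0) * ?M $$ (s, 1) - ?M $$ (r, 1) * ?M $$ (s, 0) \<in> kalman_ideal n"
    if "r < s" "s < (n - 2) + (n - 2)" for r s
  proof -
    have "minors 2 ?M \<subseteq> kalman_ideal n"
      unfolding kalman_ideal_def using minors_kalman_subset_kernel[OF assms, where 'k='k]
      by (intro ring.genideal_self[OF ring_entry_ring]) (auto simp: param_kernel_def)
    moreover have "?M $$ (r, 0) * ?M $$ (s, 1) - ?M $$ (r, 1) * ?M $$ (s, 0) \<in> minors 2 ?M"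
      unfolding minors_2_two_columns[OF kalman_dims(2)] kalman_dims using that by blast
    ultimately show ?thesis by blast
  qed
  have "quadric i j \<in> (kalman_ideal n :: 'k entry_poly set)" if "3 \<le> i" "i < j" "j \<le> n" for i j
  proof -
    define r s where "r = i - 3" and "s = j - 3"
    have "i = r + 3" "j = s + 3" "r < s" "s < n - 2"
      using that by (auto simp: r_def s_def)
    then show ?thesis
      using minor[of r s] by (simp add: kalman_index quadric_def numeral_2_eq_2[symmetric])
  qed
  moreover have "cubic i j \<in> (kalman_ideal n :: 'k entry_poly set)" if "3 \<le> i" "i \<le> j" "j \<le> n" for i j
  proof -
    define r s where "r = i - 3" and "s = j - 3"
    have rs: "i = r + 3" "j = s + 3" "r < n - 2" "s < n - 2"
      using that by (auto simp: r_def s_def)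
    obtain N where "n = N + 2"
      using assms by (intro that[of "n - 2"]) simp
    \<comment> \<open>Row n - 2 + s is row s of the lower half. The minor starts with x_i (b x_j + d
      y_j), hence the sign. Writing n as N + 2 removes the truncated subtraction.\<close>
    then have "?M $$ (r, 0) * ?M $$ (n - 2 + s, 1) - ?M $$ (r, 1) * ?M $$ (n - 2 + s, 0) = - cubic i j"
      using rs by (simp add: kalman_index cubic_def numeral_2_eq_2[symmetric] algebra_simps)
    with minor[of r "n - 2 + s"] rs have "- cubic i j \<in> (kalman_ideal n :: 'k entry_poly set)"
      by simp
    from idl(5)[OF idl(2) this] show ?thesis by simp
  qed
  ultimately show ?thesis
    by (auto simp: quadrics_def cubics_def)
qed

section \<open>The generators generate the kernel\<close>

abbreviation generators :: "nat \<Rightarrow> 'k::comm_ring_1 entry_poly set" where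
  "generators n \<equiv> quadrics n \<union> cubics n"

lemma generators_in_carrier: "generators n \<subseteq> carrier (entry_ring n :: 'k::comm_ring_1 entry_poly ring)"
  by (auto simp: quadrics_def cubics_def quadric_in_carrier cubic_in_carrier)

lemma monomial_diff_add:
  fixes \<nu> l :: monomial
  assumes "\<And>v. Poly_Mapping.lookup l v \<le> Poly_Mapping.lookup \<nu> v"
  shows "\<nu> = (\<nu> - l) + l"
  by (rule poly_mapping_eqI) (simp add: lookup_add lookup_minus assms)

lemma nonstandard_reducible:
  assumes "\<nu> \<in> monomials n" "\<nu> \<notin> standard_monomials n"
  shows "\<exists>g\<in>generators n :: 'k::comm_ring_1 entry_poly set. \<exists>\<kappa> l. \<nu> = \<kappa> + l \<and> Poly_Mapping.lookup g l = 1 \<and>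
      (\<forall>m\<in>Poly_Mapping.keys g. m \<le> l \<and> mdegree m = mdegree l)"
proof -
  consider (quadric) i j where "3 \<le> i" "i < j" "j \<le> n"
      "Poly_Mapping.lookup \<nu> (i, 1) \<noteq> 0" "Poly_Mapping.lookup \<nu> (j, 2) \<noteq> 0"
    | (cubic) i j where "3 \<le> i" "i \<le> j" "j \<le> n" "Poly_Mapping.lookup \<nu> (1, 1) \<noteq> 0"
      "Poly_Mapping.lookup \<nu> (i, 2) \<noteq> 0" "Poly_Mapping.lookup \<nu> (j, 1) \<noteq> 0"
    using assms unfolding standard_monomials_def by blast
  then show ?thesis
  proof cases
    case quadric
    let ?l = "var i 1 + var j 2"
    have "\<nu> = (\<nu> - ?l) + ?l"
      using quadric by (intro monomial_diff_add) (auto simp: lookup_add lookup_single when_def)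
    moreover have "mdegree m = mdegree ?l" if "m \<in> Poly_Mapping.keys (quadric i j :: 'k entry_poly)" for m
      using keys_quadric[of i j, where 'k='k] that by (auto simp: mdegree_add)
    moreover have "(quadric i j :: 'k entry_poly) \<in> generators n"
      using quadric by (auto simp: quadrics_def)
    ultimately show ?thesis
      using lookup_quadric_lead[OF quadric(2)] keys_quadric_le[OF quadric(2)] by blast
  next
    case cubic
    let ?l = "var 1 1 + var i 2 + var j 1"
    have "\<nu> = (\<nu> - ?l) + ?l"
      using cubic by (intro monomial_diff_add) (auto simp: lookup_add lookup_single when_def)
    moreover have "mdegree m = mdegree ?l" if "m \<in> Poly_Mapping.keys (cubic i j :: 'k entry_poly)" for m
      using keys_cubic[of i j, where 'k='k] that by (auto simp: mdegree_add)
    moreover have "(cubic i j :: 'k entry_poly) \<in> generators n"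
      using cubic by (auto simp: cubics_def)
    moreover have "3 \<le> j"
      using cubic by simp
    ultimately show ?thesis
      using lookup_cubic_lead[OF cubic(1)] keys_cubic_le[OF cubic(1)] by blast
  qed
qed

text \<open>The order bound serves the Groebner property, the degree bound the Hilbert
  series.\<close>

lemma reduce_polynomial:
  fixes I :: "'k::comm_ring_1 entry_poly set"
  assumes I: "ideal I (entry_ring n)" and "generators n \<subseteq> I" and "f \<in> carrier (entry_ring n)"
  shows "\<exists>r. f - r \<in> I \<and> (\<forall>\<mu>\<in>Poly_Mapping.keys r. \<exists>m\<in>Poly_Mapping.keys f.
    \<mu> \<in> standard_monomials n \<and> \<mu> \<le> m \<and> mdegree \<mu> = mdegree m)"
proof (rule reduce_linear[OF I])
  fix m
  assume "m \<in> Poly_Mapping.keys f"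
  then have "m \<in> monomials n"
    using assms(3) by (auto simp: carrier_entry_ring)
  have "\<exists>r. Poly_Mapping.single m 1 - r \<in> I \<and> (\<forall>\<mu>\<in>Poly_Mapping.keys r.
      \<mu> \<in> standard_monomials n \<inter> monomials n \<and> \<mu> \<le> m \<and> mdegree \<mu> = mdegree m)"
    using \<open>m \<in> monomials n\<close> by (rule reduce_monomial[OF I assms(2) nonstandard_reducible, rotated 2])
  then obtain r where "Poly_Mapping.single m 1 - r \<in> I"
    "\<forall>\<mu>\<in>Poly_Mapping.keys r. \<mu> \<in> standard_monomials n \<inter> monomials n \<and> \<mu> \<le> m \<and> mdegree \<mu> = mdegree m"
    by (elim exE conjE)
  then show "\<exists>r. Poly_Mapping.single m 1 - r \<in> I \<and>
      (\<forall>\<mu>\<in>Poly_Mapping.keys r. \<mu> \<in> standard_monomials n \<and> \<mu> \<le> m \<and> mdegree \<mu> = mdegree m)"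
    by (intro exI[of _ r]) simp
qed

lemma generators_subset_kernel:
  assumes "3 \<le> n"
  shows "generators n \<subseteq> (param_kernel n :: 'k::comm_ring_1 entry_poly set)"
  by (rule order_trans[OF generators_subset_kalman[OF assms] kalman_ideal_subset_kernel[OF assms]])

text \<open>The remainder of an element of the kernel is again in the kernel, and it is a
  combination of standard monomials, so it is zero by independence.\<close>

lemma genideal_generators_eq_kernel:
  assumes "3 \<le> n"
  shows "Idl\<^bsub>entry_ring n\<^esub> (generators n) = (param_kernel n :: 'k::comm_ring_1 entry_poly set)" (is "?J = _")
proof
  have J: "ideal ?J (entry_ring n)" "generators n \<subseteq> ?J"
    using ring.genideal_ideal[OF ring_entry_ring generators_in_carrier]
      ring.genideal_self[OF ring_entry_ring generators_in_carrier] by simp_all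
  show sub: "?J \<subseteq> param_kernel n"
    by (rule ring.genideal_minimal[OF ring_entry_ring ideal_param_kernel generators_subset_kernel[OF assms]])
  show "param_kernel n \<subseteq> ?J"
  proof
    fix f :: "'k entry_poly"
    assume f: "f \<in> param_kernel n"
    then obtain r where r: "f - r \<in> ?J" "Poly_Mapping.keys r \<subseteq> standard_monomials n"
      using reduce_polynomial[OF J, of f] by (auto simp: param_kernel_def)
    have "param n f = 0" "param n (f - r) = 0"
      using f r(1) sub by (auto simp: param_kernel_def)
    then have "param n r = 0"
      by (simp add: param_diff)
    then have "r = 0"
      using standard_independent r(2) by blast
    with r(1) show "f \<in> ?J" by simp
  qed
qed

text \<open>The ideal of minors lies between the ideal of the generators and the kernel, which
  coincide.\<close>

lemma kalman_ideal_eq_kernel: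
  assumes "3 \<le> n"
  shows "kalman_ideal n = (param_kernel n :: 'k::comm_ring_1 entry_poly set)"
proof
  show "param_kernel n \<subseteq> (kalman_ideal n :: 'k entry_poly set)"
    unfolding genideal_generators_eq_kernel[OF assms, symmetric]
    by (rule ring.genideal_minimal[OF ring_entry_ring ideal_kalman generators_subset_kalman]) (rule assms)+
qed (rule kalman_ideal_subset_kernel[OF assms])

section \<open>The Groebner basis\<close>

lemma keys_diff_single:
  "Poly_Mapping.keys (f - Poly_Mapping.single m (Poly_Mapping.lookup f m)) \<subseteq> Poly_Mapping.keys f - {m}"
  by (auto simp: in_keys_iff lookup_minus lookup_single when_def split: if_splits)

lemma diff_single_in_carrier:
  assumes "f \<in> carrier (entry_ring n)"
  shows "f - Poly_Mapping.single m (Poly_Mapping.lookup f m) \<in> carrier (entry_ring n)"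
  using assms keys_diff_single[of f m] unfolding carrier_entry_ring by blast

lemma single_add_remainder_notin_kernel:
  fixes r :: "'k::comm_ring_1 entry_poly"
  assumes "\<mu> \<in> standard_monomials n" "Poly_Mapping.keys r \<subseteq> standard_monomials n - {\<mu>}" "c \<noteq> 0"
  shows "Poly_Mapping.single \<mu> c + r \<notin> param_kernel n"
proof
  assume "Poly_Mapping.single \<mu> c + r \<in> param_kernel n"
  then have "param n (Poly_Mapping.single \<mu> c + r) = 0"
    by (simp only: param_kernel_def mem_Collect_eq)
  moreover have "Poly_Mapping.keys (Poly_Mapping.single \<mu> c + r) \<subseteq> standard_monomials n"
    using Poly_Mapping.keys_add[of "Poly_Mapping.single \<mu> c" r] assms by auto
  ultimately have "Poly_Mapping.single \<mu> c + r = 0"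
    by (rule standard_independent[rotated])
  then have "Poly_Mapping.lookup (Poly_Mapping.single \<mu> c + r) \<mu> = 0"
    by (simp only: lookup_zero)
  moreover have "\<mu> \<notin> Poly_Mapping.keys r"
    using assms(2) by blast
  ultimately show False
    using assms(3) by (simp add: lookup_add in_keys_iff)
qed

text \<open>Only the part of \<open>f\<close> below \<mu> is reduced. The order bound keeps the
  remainder away from \<mu>, so the term at \<mu> cannot cancel. If \<mu> were standard with nonzero
  coefficient, the result would contradict independence.\<close>

lemma exists_lower_remainder:
  fixes f :: "'k::comm_ring_1 entry_poly"
  assumes n: "3 \<le> n" and f: "f \<in> param_kernel n"
    and max: "\<And>m. m \<in> Poly_Mapping.keys f \<Longrightarrow> m \<le> \<mu>"
  shows "\<exists>r. Poly_Mapping.single \<mu> (Poly_Mapping.lookup f \<mu>) + r \<in> param_kernel n \<and>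
    Poly_Mapping.keys r \<subseteq> standard_monomials n - {\<mu>}"
proof -
  let ?c = "Poly_Mapping.single \<mu> (Poly_Mapping.lookup f \<mu>)"
  have carrier: "f \<in> carrier (entry_ring n)"
    using f by (simp add: param_kernel_def)
  obtain r where r: "f - ?c - r \<in> param_kernel n" "\<forall>\<rho>\<in>Poly_Mapping.keys r. \<exists>m\<in>Poly_Mapping.keys (f - ?c).
      \<rho> \<in> standard_monomials n \<and> \<rho> \<le> m \<and> mdegree \<rho> = mdegree m"
    using reduce_polynomial[OF ideal_param_kernel generators_subset_kernel[OF n] diff_single_in_carrier[OF carrier, of \<mu>]]
    by (elim exE conjE)
  have "f - (f - ?c - r) \<in> param_kernel n"
    by (rule ideal_entry_ringD(5)[OF ideal_param_kernel f r(1)])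
  then have "?c + r \<in> param_kernel n"
    by simp
  moreover have "\<rho> \<noteq> \<mu>" if "m \<in> Poly_Mapping.keys (f - ?c)" "\<rho> \<le> m" for \<rho> m
    using that max[of m] keys_diff_single[of f \<mu>] by auto
  with r(2) have "Poly_Mapping.keys r \<subseteq> standard_monomials n - {\<mu>}"
    by blast
  ultimately show ?thesis
    by blast
qed

lemma kernel_leading_monomial_nonstandard:
  fixes f :: "'k::comm_ring_1 entry_poly"
  assumes "3 \<le> n" "f \<in> param_kernel n" "\<mu> \<in> Poly_Mapping.keys f"
    and "\<And>m. m \<in> Poly_Mapping.keys f \<Longrightarrow> m \<le> \<mu>"
  shows "\<mu> \<notin> standard_monomials n"
  using exists_lower_remainder[OF assms(1,2,4)] assms(3) single_add_remainder_notin_kernel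
  by (metis in_keys_iff)

lemma finite_generators: "finite (generators n :: 'k::comm_ring_1 entry_poly set)"
proof -
  have "quadrics n \<subseteq> (\<lambda>(i, j). quadric i j :: 'k entry_poly) ` ({..n} \<times> {..n})"
    "cubics n \<subseteq> (\<lambda>(i, j). cubic i j :: 'k entry_poly) ` ({..n} \<times> {..n})"
    by (auto simp: quadrics_def cubics_def image_iff)
  then show ?thesis
    by (meson finite_Un finite_SigmaI finite_atMost finite_imageI finite_subset)
qed

lemma leading_term_in_carrier:
  fixes f :: "'k::comm_ring_1 entry_poly"
  assumes "f \<in> carrier (entry_ring n)" "f \<noteq> 0"
  shows "leading_term f \<in> carrier (entry_ring n)"
proof -
  have "Max (Poly_Mapping.keys f) \<in> Poly_Mapping.keys f"
    using assms(2) by (intro Max_in) auto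
  then show ?thesis
    using assms(1) by (auto simp: leading_term_def Let_def carrier_entry_ring)
qed

text \<open>The leading monomial of a nonzero element of the kernel is not standard, so by
  \<open>nonstandard_reducible\<close> it is a multiple of the leading monomial of a
  generator.\<close>

lemma groebner_basis_generators:
  assumes n: "3 \<le> n"
  shows "is_groebner_basis n (generators n) (kalman_ideal n :: 'k::comm_ring_1 entry_poly set)"
proof -
  let ?K = "kalman_ideal n :: 'k entry_poly set" and ?G = "generators n :: 'k entry_poly set"
  let ?R = "entry_ring n :: 'k entry_poly ring"
  have K: "?K = param_kernel n"
    by (rule kalman_ideal_eq_kernel[OF n])
  have G: "?G \<subseteq> ?K"
    by (rule generators_subset_kalman[OF n])
  have carr: "leading_term ` (?K - {0}) \<subseteq> carrier ?R"
    using leading_term_in_carrier by (auto simp: K param_kernel_def)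
  then have carr': "leading_term ` (?G - {0}) \<subseteq> carrier ?R"
    using G by blast
  have "Idl\<^bsub>?R\<^esub> (leading_term ` (?G - {0})) \<subseteq> Idl\<^bsub>?R\<^esub> (leading_term ` (?K - {0}))"
    using ring.genideal_self[OF ring_entry_ring carr] G
    by (intro ring.genideal_minimal[OF ring_entry_ring ring.genideal_ideal[OF ring_entry_ring carr]]) blast
  moreover have "Idl\<^bsub>?R\<^esub> (leading_term ` (?K - {0})) \<subseteq> Idl\<^bsub>?R\<^esub> (leading_term ` (?G - {0}))"
  proof (rule ring.genideal_minimal[OF ring_entry_ring ring.genideal_ideal[OF ring_entry_ring carr']],
      rule image_subsetI)
    fix f
    assume "f \<in> ?K - {0}"
    then have f: "f \<in> ?K" "f \<noteq> 0"
      by simp_all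
    define \<mu> where "\<mu> = Max (Poly_Mapping.keys f)"
    have \<mu>: "\<mu> \<in> Poly_Mapping.keys f"
      using f(2) unfolding \<mu>_def by (intro Max_in) auto
    moreover have "m \<le> \<mu>" if "m \<in> Poly_Mapping.keys f" for m
      unfolding \<mu>_def using that by (intro Max_ge) simp_all
    ultimately have "\<mu> \<notin> standard_monomials n"
      using f(1) unfolding K by (intro kernel_leading_monomial_nonstandard[OF n])
    moreover have "\<mu> \<in> monomials n"
      using f(1) \<mu> by (auto simp: K param_kernel_def carrier_entry_ring)
    ultimately obtain g \<kappa> l where g: "g \<in> ?G" "\<mu> = \<kappa> + l" "Poly_Mapping.lookup g l = 1"
      "\<forall>m\<in>Poly_Mapping.keys g. m \<le> l \<and> mdegree m = mdegree l"
      using nonstandard_reducible[where 'k='k] by meson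
    have "g \<noteq> 0"
      using g(3) by auto
    have "leading_term g = Poly_Mapping.single l 1"
      using g by (intro leading_term_eq) auto
    then have "leading_term f = Poly_Mapping.single \<kappa> (Poly_Mapping.lookup f \<mu>) * leading_term g"
      by (simp add: leading_term_def[of f] \<mu>_def[symmetric] mult_single g(2) Let_def)
    moreover have "leading_term g \<in> Idl\<^bsub>?R\<^esub> (leading_term ` (?G - {0}))"
      using ring.genideal_self[OF ring_entry_ring carr'] g(1) \<open>g \<noteq> 0\<close> by blast
    moreover have "Poly_Mapping.single \<kappa> (Poly_Mapping.lookup f \<mu>) \<in> carrier ?R"
      using monomials_addD(1) \<open>\<mu> \<in> monomials n\<close> g(2) by (intro single_in_carrier) simp
    ultimately show "leading_term f \<in> Idl\<^bsub>?R\<^esub> (leading_term ` (?G - {0}))"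
      using ideal_entry_ringD(4)[OF ring.genideal_ideal[OF ring_entry_ring carr']] by simp
  qed
  ultimately show ?thesis
    unfolding is_groebner_basis_def using finite_generators G by blast
qed

section \<open>Minimality of the generators\<close>

text \<open>If a product of monomials divides \<mu>, so does each factor; hence multiplication
  creates no new divisor of \<mu>. This gives a certificate of non-membership: polynomials without
  divisors of \<mu> never generate a polynomial with one.\<close>

lemma ideal_no_divisor:
  "ideal {p \<in> carrier (entry_ring n). \<forall>m\<in>Poly_Mapping.keys p. \<nexists>\<kappa>. \<mu> = \<kappa> + m}
    (entry_ring n :: 'k::comm_ring_1 entry_poly ring)"
proof (rule ideal_entry_ringI)
  fix r p :: "'k entry_poly"
  assume r: "r \<in> carrier (entry_ring n)"
    and p: "p \<in> {p \<in> carrier (entry_ring n). \<forall>m\<in>Poly_Mapping.keys p. \<nexists>\<kappa>. \<mu> = \<kappa> + m}"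
  have "\<nexists>\<kappa>. \<mu> = \<kappa> + m" if m: "m \<in> Poly_Mapping.keys (r * p)" for m
  proof -
    obtain a b where "m = a + b" "b \<in> Poly_Mapping.keys p"
      using keys_mult[of r p] m by blast
    moreover have "\<mu> \<noteq> (\<kappa> + a) + b" for \<kappa>
      using p \<open>b \<in> Poly_Mapping.keys p\<close> by blast
    ultimately show ?thesis
      by (simp add: add.assoc)
  qed
  then show "r * p \<in> {p \<in> carrier (entry_ring n). \<forall>m\<in>Poly_Mapping.keys p. \<nexists>\<kappa>. \<mu> = \<kappa> + m}"
    using r p carrier_entry_ring_closed(3) by blast
next
  fix p q :: "'k entry_poly"
  assume pq: "p \<in> {p \<in> carrier (entry_ring n). \<forall>m\<in>Poly_Mapping.keys p. \<nexists>\<kappa>. \<mu> = \<kappa> + m}"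
    "q \<in> {p \<in> carrier (entry_ring n). \<forall>m\<in>Poly_Mapping.keys p. \<nexists>\<kappa>. \<mu> = \<kappa> + m}"
  have "Poly_Mapping.keys (p + q) \<subseteq> Poly_Mapping.keys p \<union> Poly_Mapping.keys q"
    by (rule Poly_Mapping.keys_add)
  then show "p + q \<in> {p \<in> carrier (entry_ring n). \<forall>m\<in>Poly_Mapping.keys p. \<nexists>\<kappa>. \<mu> = \<kappa> + m}"
    using pq carrier_entry_ring_closed(1) by blast
qed (auto simp: carrier_entry_ring)

text \<open>A divisor x_k y_l fixes the indices at once, while y_k x_l would need k = j and l = i,
  against both orderings.\<close>

lemma quadric_divisor:
  assumes "i < j" "k < l" "m \<in> Poly_Mapping.keys (quadric k l :: 'k::comm_ring_1 entry_poly)"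
    and eq: "var i 1 + var j 2 = \<kappa> + m"
  shows "k = i \<and> l = j"
proof -
  have le: "Poly_Mapping.lookup m v \<le> Poly_Mapping.lookup (var i 1 + var j 2) v" for v
    unfolding eq by (simp add: lookup_add)
  have "m = var k 1 + var l 2 \<or> m = var k 2 + var l 1"
    using keys_quadric[of k l, where 'k='k] assms(3) by blast
  then show ?thesis
  proof
    assume m: "m = var k 1 + var l 2"
    show ?thesis
      using le[of "(k, 1)"] le[of "(l, 2)"]
      by (auto simp: m lookup_add lookup_single when_def split: if_splits)
  next
    assume m: "m = var k 2 + var l 1"
    show ?thesis
      using le[of "(k, 2)"] le[of "(l, 1)"] assms(1,2)
      by (auto simp: m lookup_add lookup_single when_def split: if_splits)
  qed
qed

text \<open>Every monomial of a cubic contains one of a, b, c, d.\<close>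

lemma cubic_not_divisor_quadric:
  assumes "3 \<le> i" "3 \<le> j" "m \<in> Poly_Mapping.keys (cubic k l :: 'k::comm_ring_1 entry_poly)"
  shows "var i 1 + var j 2 \<noteq> \<kappa> + m"
proof
  assume eq: "var i 1 + var j 2 = \<kappa> + m"
  have le: "Poly_Mapping.lookup m v \<le> Poly_Mapping.lookup (var i 1 + var j 2) v" for v
    unfolding eq by (simp add: lookup_add)
  have "Poly_Mapping.lookup m (1, 1) \<noteq> 0 \<or> Poly_Mapping.lookup m (1, 2) \<noteq> 0
      \<or> Poly_Mapping.lookup m (2, 1) \<noteq> 0 \<or> Poly_Mapping.lookup m (2, 2) \<noteq> 0"
    using subsetD[OF keys_cubic assms(3)] by (auto simp: lookup_add)
  then show False
    using le[of "(1, 1)"] le[of "(1, 2)"] le[of "(2, 1)"] le[of "(2, 2)"] assms(1,2)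
    by (simp add: lookup_add lookup_single when_def)
qed

text \<open>The witness for a cubic is its monomial b x_i x_j, which contains no y. The leading
  monomial a y_i x_j would fail for i < j, as y_i x_j is a monomial of the quadric with the same
  indices.\<close>

lemma quadric_not_divisor_cubic:
  assumes "3 \<le> k" "3 \<le> l" "m \<in> Poly_Mapping.keys (quadric k l :: 'k::comm_ring_1 entry_poly)"
  shows "var 1 2 + var i 1 + var j 1 \<noteq> \<kappa> + m"
proof
  assume eq: "var 1 2 + var i 1 + var j 1 = \<kappa> + m"
  have le: "Poly_Mapping.lookup m v \<le> Poly_Mapping.lookup (var 1 2 + var i 1 + var j 1) v" for v
    unfolding eq by (simp add: lookup_add)
  have "Poly_Mapping.lookup m (k, 2) \<noteq> 0 \<or> Poly_Mapping.lookup m (l, 2) \<noteq> 0"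
    using keys_quadric[of k l, where 'k='k] assms(3) by (auto simp: lookup_add)
  then show False
    using le[of "(k, 2)"] le[of "(l, 2)"] assms(1,2)
    by (simp add: lookup_add lookup_single when_def)
qed

text \<open>The other three monomials of a cubic contain a, c or d. This leaves b x_k x_l, and the
  orderings i \<le> j and k \<le> l remove the symmetry.\<close>

lemma cubic_divisor:
  assumes "3 \<le> i" "i \<le> j" "3 \<le> k" "k \<le> l" "m \<in> Poly_Mapping.keys (cubic k l :: 'k::comm_ring_1 entry_poly)"
    and eq: "var 1 2 + var i 1 + var j 1 = \<kappa> + m"
  shows "k = i \<and> l = j"
proof -
  have le: "Poly_Mapping.lookup m v \<le> Poly_Mapping.lookup (var 1 2 + var i 1 + var j 1) v" for v
    unfolding eq by (simp add: lookup_add)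
  have zero: "Poly_Mapping.lookup m (1, 1) = 0" "Poly_Mapping.lookup m (2, 1) = 0" "Poly_Mapping.lookup m (2, 2) = 0"
    using le[of "(1, 1)"] le[of "(2, 1)"] le[of "(2, 2)"] assms(1,2)
    by (simp_all add: lookup_add lookup_single when_def)
  have m: "m = var 1 2 + var k 1 + var l 1"
    using subsetD[OF keys_cubic assms(5)] zero by (auto simp: lookup_add)
  show ?thesis
    using le[of "(k, 1)"] le[of "(l, 1)"] assms(1-4)
    by (auto simp: m lookup_add lookup_single when_def split: if_splits)
qed

lemma key_cubic:
  assumes "3 \<le> i" "3 \<le> j"
  shows "var 1 2 + var i 1 + var j 1 \<in> Poly_Mapping.keys (cubic i j :: 'k::comm_ring_1 entry_poly)"
proof -
  let ?m = "var 1 2 + var i 1 + var j 1"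
  have one: "Poly_Mapping.lookup ?m (1, 2) = 1"
    using assms by (simp add: lookup_add lookup_single when_def)
  have "Poly_Mapping.lookup (var a b + var i c + var j d) (1, 2) = 0" if "(a, b) \<noteq> (1, 2)" for a b c d
    using assms that by (auto simp: lookup_add lookup_single when_def)
  then have "var 1 1 + var i 2 + var j 1 \<noteq> ?m" "var 2 1 + var i 2 + var j 2 \<noteq> ?m" "var 2 2 + var i 1 + var j 2 \<noteq> ?m"
    using one by (metis prod.inject numeral_One numeral_eq_iff semiring_norm(85) zero_neq_one)+
  then have "Poly_Mapping.lookup (cubic i j :: 'k entry_poly) ?m = - 1"
    unfolding cubic_eq lookup_add lookup_minus lookup_single
    by (simp only: when_def if_False refl if_True) simp
  then show ?thesis
    by (simp add: in_keys_iff)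
qed

lemma key_quadric:
  assumes "i < j"
  shows "var i 1 + var j 2 \<in> Poly_Mapping.keys (quadric i j :: 'k::comm_ring_1 entry_poly)"
  using lookup_quadric_lead[OF assms, where 'k='k] by (simp add: in_keys_iff)

lemma generator_indispensable:
  assumes g: "g \<in> (generators n :: 'k::comm_ring_1 entry_poly set)"
  shows "\<exists>\<mu>. (\<exists>m\<in>Poly_Mapping.keys g. \<exists>\<kappa>. \<mu> = \<kappa> + m) \<and>
    (\<forall>h\<in>generators n - {g}. \<forall>m\<in>Poly_Mapping.keys h. \<nexists>\<kappa>. \<mu> = \<kappa> + m)"
proof -
  have self: "\<exists>\<kappa>. \<mu> = \<kappa> + \<mu>" for \<mu> :: monomial
    by (rule exI[of _ 0]) simp
  from g consider (quadric) i j where "g = quadric i j" "3 \<le> i" "i < j" "j \<le> n"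
    | (cubic) i j where "g = cubic i j" "3 \<le> i" "i \<le> j" "j \<le> n"
    by (auto simp: quadrics_def cubics_def)
  then show ?thesis
  proof cases
    case quadric
    have "\<nexists>\<kappa>. var i 1 + var j 2 = \<kappa> + m" if h: "h \<in> generators n - {g}" "m \<in> Poly_Mapping.keys h" for h m
    proof -
      from h(1) consider k l where "h = quadric k l" "(k, l) \<noteq> (i, j)" "k < l" | k l where "h = cubic k l"
        using quadric(1) by (auto simp: quadrics_def cubics_def)
      then show ?thesis
      proof cases
        case (1 k l)
        then show ?thesis
          using quadric_divisor[of i j k l m, where 'k='k] h(2) quadric by blast
      next
        case (2 k l)
        then show ?thesis
          using cubic_not_divisor_quadric[of i j m k l, where 'k='k] h(2) quadric by auto
      qed
    qed
    then show ?thesis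
      using self key_quadric[OF quadric(3)] unfolding quadric(1) by blast
  next
    case cubic
    have "\<nexists>\<kappa>. var 1 2 + var i 1 + var j 1 = \<kappa> + m" if h: "h \<in> generators n - {g}" "m \<in> Poly_Mapping.keys h" for h m
    proof -
      from h(1) consider k l where "h = quadric k l" "3 \<le> k" "3 \<le> l" | k l where "h = cubic k l" "(k, l) \<noteq> (i, j)" "3 \<le> k" "k \<le> l"
        using cubic(1) by (auto simp: quadrics_def cubics_def)
      then show ?thesis
      proof cases
        case (1 k l)
        then show ?thesis
          using quadric_not_divisor_cubic[of k l m i j, where 'k='k] h(2) by auto
      next
        case (2 k l)
        then show ?thesis
          using cubic_divisor[of i j k l m, where 'k='k] h(2) cubic by blast
      qed
    qed
    moreover have "3 \<le> j"
      using cubic by simp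
    ultimately show ?thesis
      using self key_cubic[OF cubic(2)] unfolding cubic(1) by blast
  qed
qed

lemma minimally_generates_generators:
  assumes n: "3 \<le> n"
  shows "minimally_generates (entry_ring n) (generators n) (kalman_ideal n :: 'k::comm_ring_1 entry_poly set)"
proof -
  let ?G = "generators n :: 'k entry_poly set" and ?R = "entry_ring n :: 'k entry_poly ring"
  have "Idl\<^bsub>?R\<^esub> ?G = kalman_ideal n"
    by (simp only: genideal_generators_eq_kernel[OF n] kalman_ideal_eq_kernel[OF n])
  moreover have "Idl\<^bsub>?R\<^esub> H \<noteq> kalman_ideal n" if sub: "H \<subset> ?G" for H
  proof
    assume H: "Idl\<^bsub>?R\<^esub> H = kalman_ideal n"
    obtain g where g: "g \<in> ?G" "g \<notin> H"
      using sub by blast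
    obtain \<mu> where \<mu>: "\<exists>m\<in>Poly_Mapping.keys g. \<exists>\<kappa>. \<mu> = \<kappa> + m"
      "\<forall>h\<in>?G - {g}. \<forall>m\<in>Poly_Mapping.keys h. \<nexists>\<kappa>. \<mu> = \<kappa> + m"
      using generator_indispensable[OF g(1)] by blast
    let ?N = "{p \<in> carrier ?R. \<forall>m\<in>Poly_Mapping.keys p. \<nexists>\<kappa>. \<mu> = \<kappa> + m}"
    have "H \<subseteq> ?N"
      using sub g(2) \<mu>(2) generators_in_carrier[of n, where 'k='k] by blast
    then have "Idl\<^bsub>?R\<^esub> H \<subseteq> ?N"
      by (rule ring.genideal_minimal[OF ring_entry_ring ideal_no_divisor])
    then have "g \<in> ?N"
      using H generators_subset_kalman[OF n, where 'k='k] g(1) by blast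
    with \<mu>(1) show False by blast
  qed
  ultimately show ?thesis
    unfolding minimally_generates_def using generators_in_carrier by blast
qed

lemma card_quadrics:
  assumes "3 \<le> n"
  shows "card (quadrics n :: 'k::comm_ring_1 entry_poly set) = (n - 2) choose 2"
proof -
  \<comment> \<open>The larger index comes first, so that the cardinality becomes a sum over j of j
    - 3, suited to induction on n.\<close>
  let ?S = "SIGMA j:{3..n}. {3..<j}"
  have "quadrics n = (\<lambda>(j, i). quadric i j :: 'k entry_poly) ` ?S"
    by (fastforce simp: quadrics_def image_iff)
  moreover have "inj_on (\<lambda>(j, i). quadric i j :: 'k entry_poly) ?S"
  proof (rule inj_onI, clarsimp)
    fix i j k l
    assume eq: "quadric i j = (quadric k l :: 'k entry_poly)" and "i < j" "k < l"
    have "var i 1 + var j 2 \<in> Poly_Mapping.keys (quadric k l :: 'k entry_poly)"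
      unfolding eq[symmetric] by (rule key_quadric) fact
    \<comment> \<open>With \<kappa> = 0 the divisor lemma says that the leading monomial determines
      the indices.\<close>
    from quadric_divisor[OF \<open>i < j\<close> \<open>k < l\<close> this add_0[symmetric]]
    show "j = l \<and> i = k" by blast
  qed
  ultimately have "card (quadrics n :: 'k entry_poly set) = (\<Sum>j=3..n. j - 3)"
    by (simp add: card_image)
  also have "\<dots> = (n - 2) choose 2"
    using assms
  proof (induction n rule: nat_induct_at_least)
    case (Suc n)
    define k where "k = n - 2"
    have "n = Suc (Suc k)"
      using Suc.hyps by (simp add: k_def)
    then show ?case
      using Suc.hyps Suc.IH by (simp add: numeral_2_eq_2)
  qed (simp add: numeral_2_eq_2)
  finally show ?thesis .
qed

lemma card_cubics:
  assumes "3 \<le> n"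
  shows "card (cubics n :: 'k::comm_ring_1 entry_poly set) = (n - 1) choose 2"
proof -
  let ?S = "SIGMA j:{3..n}. {3..j}"
  have "cubics n = (\<lambda>(j, i). cubic i j :: 'k entry_poly) ` ?S"
    by (fastforce simp: cubics_def image_iff)
  moreover have "inj_on (\<lambda>(j, i). cubic i j :: 'k entry_poly) ?S"
  proof (rule inj_onI, clarsimp)
    fix i j k l
    assume eq: "cubic i j = (cubic k l :: 'k entry_poly)" and ij: "3 \<le> i" "i \<le> j" and kl: "3 \<le> k" "k \<le> l"
    have "var 1 2 + var i 1 + var j 1 \<in> Poly_Mapping.keys (cubic k l :: 'k entry_poly)"
      unfolding eq[symmetric] by (rule key_cubic) (use ij in auto)
    from cubic_divisor[OF ij kl this add_0[symmetric]]
    show "j = l \<and> i = k" by blast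
  qed
  ultimately have "card (cubics n :: 'k entry_poly set) = (\<Sum>j=3..n. Suc j - 3)"
    by (simp add: card_image)
  also have "\<dots> = (n - 1) choose 2"
    using assms
  proof (induction n rule: nat_induct_at_least)
    case (Suc n)
    define k where "k = n - 2"
    have "n = Suc (Suc k)"
      using Suc.hyps by (simp add: k_def)
    then show ?case
      using Suc.hyps Suc.IH by (simp add: numeral_2_eq_2)
  qed (simp add: numeral_2_eq_2)
  finally show ?thesis .
qed

section \<open>Counting standard monomials\<close>

definition counting_series :: "('a \<Rightarrow>\<^sub>0 nat) set \<Rightarrow> rat fps" where
  "counting_series M = Abs_fps (\<lambda>d. of_nat (card {m \<in> M. mdegree m = d}))"

lemma finite_degree_part:
  assumes "finite V" "\<And>m. m \<in> M \<Longrightarrow> Poly_Mapping.keys m \<subseteq> V"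
  shows "finite {m \<in> M. mdegree m = d}"
  by (rule finite_subset[OF _ finite_mdegree[OF assms(1), of d]]) (use assms(2) in auto)

text \<open>Needed with a nonempty intersection for the two families of standard monomials that
  contain a.\<close>

lemma counting_series_Un_Int:
  assumes "finite V" "\<And>m. m \<in> M \<union> N \<Longrightarrow> Poly_Mapping.keys m \<subseteq> V"
  shows "counting_series (M \<union> N) + counting_series (M \<inter> N) = counting_series M + counting_series N"
proof (rule fps_ext)
  fix d
  have "card {m \<in> M. mdegree m = d} + card {m \<in> N. mdegree m = d}
      = card ({m \<in> M. mdegree m = d} \<union> {m \<in> N. mdegree m = d}) + card ({m \<in> M. mdegree m = d} \<inter> {m \<in> N. mdegree m = d})"
    using assms by (intro card_Un_Int finite_degree_part[of V]) auto
  moreover have "{m \<in> M \<union> N. mdegree m = d} = {m \<in> M. mdegree m = d} \<union> {m \<in> N. mdegree m = d}"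
    "{m \<in> M \<inter> N. mdegree m = d} = {m \<in> M. mdegree m = d} \<inter> {m \<in> N. mdegree m = d}"
    by auto
  ultimately show "fps_nth (counting_series (M \<union> N) + counting_series (M \<inter> N)) d
      = fps_nth (counting_series M + counting_series N) d"
    by (simp add: counting_series_def flip: of_nat_add)
qed

lemma counting_series_empty [simp]: "counting_series {} = 0"
  by (rule fps_ext) (simp add: counting_series_def)

lemma counting_series_Un_disjoint:
  assumes "finite V" "\<And>m. m \<in> M \<union> N \<Longrightarrow> Poly_Mapping.keys m \<subseteq> V" "M \<inter> N = {}"
  shows "counting_series (M \<union> N) = counting_series M + counting_series N"
proof -
  have "counting_series (M \<union> N) + counting_series (M \<inter> N) = counting_series M + counting_series N"
    by (rule counting_series_Un_Int[OF assms(1)]) (rule assms(2))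
  then show ?thesis
    using assms(3) by simp
qed

lemma counting_series_UN_disjoint:
  assumes "finite K" "finite V" "\<And>k m. k \<in> K \<Longrightarrow> m \<in> M k \<Longrightarrow> Poly_Mapping.keys m \<subseteq> V"
    "disjoint_family_on M K"
  shows "counting_series (\<Union>k\<in>K. M k) = (\<Sum>k\<in>K. counting_series (M k))"
  using assms
proof (induction K rule: finite_induct)
  case (insert k K)
  have "M k \<inter> (\<Union>k\<in>K. M k) = {}"
    using insert.hyps(2) insert.prems(3) unfolding disjoint_family_on_def by fastforce
  then have "counting_series (M k \<union> (\<Union>k\<in>K. M k)) = counting_series (M k) + counting_series (\<Union>k\<in>K. M k)"
  proof (rule counting_series_Un_disjoint[OF insert.prems(1), rotated])
    fix m
    assume "m \<in> M k \<union> (\<Union>k\<in>K. M k)"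
    then obtain l where "l \<in> insert k K" "m \<in> M l"
      by auto
    then show "Poly_Mapping.keys m \<subseteq> V"
      by (rule insert.prems(2))
  qed
  moreover have "disjoint_family_on M K"
    using insert.prems(3) by (rule disjoint_family_on_mono[rotated]) auto
  then have "counting_series (\<Union>k\<in>K. M k) = (\<Sum>k\<in>K. counting_series (M k))"
    using insert.prems(1,2) by (intro insert.IH) auto
  ultimately show ?case
    using insert.hyps by simp
qed simp

lemma counting_series_shift:
  "counting_series ((+) u ` M) = fps_X ^ mdegree u * counting_series M"
proof (rule fps_ext)
  fix d
  show "fps_nth (counting_series ((+) u ` M)) d = fps_nth (fps_X ^ mdegree u * counting_series M) d"
  proof (cases "d < mdegree u")
    case True
    then have "{m \<in> (+) u ` M. mdegree m = d} = {}"
      by (auto simp: mdegree_add)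
    then have "card {m \<in> (+) u ` M. mdegree m = d} = 0"
      by (simp only: card.empty)
    then show ?thesis
      unfolding counting_series_def using True by (simp add: fps_X_power_mult_nth)
  next
    case False
    then have "{m \<in> (+) u ` M. mdegree m = d} = (+) u ` {m \<in> M. mdegree m = d - mdegree u}"
      by (auto simp: mdegree_add image_iff)
    then show ?thesis
      unfolding counting_series_def using False by (simp add: fps_X_power_mult_nth card_image)
  qed
qed

lemma shift_eq_keys:
  fixes V :: "'a set"
  assumes "v \<in> V"
  shows "{m :: 'a \<Rightarrow>\<^sub>0 nat. Poly_Mapping.keys m \<subseteq> V \<and> v \<in> Poly_Mapping.keys m}
    = (+) (Poly_Mapping.single v 1) ` {m. Poly_Mapping.keys m \<subseteq> V}"
proof (intro equalityI subsetI)
  fix m :: "'a \<Rightarrow>\<^sub>0 nat"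
  assume "m \<in> {m. Poly_Mapping.keys m \<subseteq> V \<and> v \<in> Poly_Mapping.keys m}"
  then have m: "Poly_Mapping.keys m \<subseteq> V" "v \<in> Poly_Mapping.keys m"
    by auto
  have "m = Poly_Mapping.single v 1 + (m - Poly_Mapping.single v 1)"
    using m(2) by (intro poly_mapping_eqI) (auto simp: lookup_add lookup_minus lookup_single when_def in_keys_iff)
  moreover have "Poly_Mapping.keys (m - Poly_Mapping.single v 1) \<subseteq> V"
    using m(1) by (auto simp: in_keys_iff lookup_minus)
  ultimately show "m \<in> (+) (Poly_Mapping.single v 1) ` {m. Poly_Mapping.keys m \<subseteq> V}"
    by blast
next
  fix m :: "'a \<Rightarrow>\<^sub>0 nat"
  assume "m \<in> (+) (Poly_Mapping.single v 1) ` {m. Poly_Mapping.keys m \<subseteq> V}"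
  then obtain m' where "m = Poly_Mapping.single v 1 + m'" "Poly_Mapping.keys m' \<subseteq> V"
    by blast
  then show "m \<in> {m. Poly_Mapping.keys m \<subseteq> V \<and> v \<in> Poly_Mapping.keys m}"
    using assms Poly_Mapping.keys_add[of "Poly_Mapping.single v 1" m']
    by (auto simp: in_keys_iff[of v] lookup_add)
qed

abbreviation geom :: "rat fps" where
  "geom \<equiv> inverse (1 - fps_X)"

lemma X_mult_geom: "fps_X * geom = geom - 1"
proof -
  have "(1 - fps_X) * geom = 1"
    by (rule inverse_mult_eq_1') simp
  then show ?thesis
    by (simp add: algebra_simps)
qed

text \<open>A monomial either omits v or is v times an arbitrary monomial. With z for
  \<open>fps_X\<close> and H for the new series this reads H = (old series) + z H, so each variable
  contributes a factor 1 / (1 - z).\<close>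

lemma counting_series_free:
  assumes "finite V"
  shows "counting_series {m. Poly_Mapping.keys m \<subseteq> V} = geom ^ card V"
  using assms
proof (induction V rule: finite_induct)
  case empty
  have "{m :: 'a \<Rightarrow>\<^sub>0 nat. Poly_Mapping.keys m \<subseteq> {}} = {0}"
    by auto
  moreover have "counting_series {0 :: 'a \<Rightarrow>\<^sub>0 nat} = 1"
  proof (rule fps_ext)
    fix d
    have "{m \<in> {0 :: 'a \<Rightarrow>\<^sub>0 nat}. mdegree m = d} = (if d = 0 then {0} else {})"
      by auto
    then show "fps_nth (counting_series {0 :: 'a \<Rightarrow>\<^sub>0 nat}) d = fps_nth 1 d"
      by (simp add: counting_series_def)
  qed
  ultimately show ?case by simp
next
  case (insert v V)
  let ?F = "\<lambda>V. {m :: 'a \<Rightarrow>\<^sub>0 nat. Poly_Mapping.keys m \<subseteq> V}"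
  let ?S = "(+) (Poly_Mapping.single v 1) ` ?F (insert v V)"
  have "?F (insert v V) = ?F V \<union> ?S"
    unfolding shift_eq_keys[OF insertI1, symmetric] by auto
  moreover have "counting_series (?F V \<union> ?S) = counting_series (?F V) + counting_series ?S"
    unfolding shift_eq_keys[OF insertI1, symmetric] using insert.hyps
    by (intro counting_series_Un_disjoint[of "insert v V"]) auto
  ultimately have "counting_series (?F (insert v V))
      = counting_series (?F V) + fps_X * counting_series (?F (insert v V))"
    by (simp add: counting_series_shift)
  then have "(1 - fps_X) * counting_series (?F (insert v V)) = geom ^ card V"
    using insert.IH by (simp add: algebra_simps)
  then have "geom * (1 - fps_X) * counting_series (?F (insert v V)) = geom * geom ^ card V"
    by (simp only: mult.assoc)
  moreover have "geom * (1 - fps_X) = 1"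
    by (rule inverse_mult_eq_1) simp
  ultimately have "counting_series (?F (insert v V)) = geom * geom ^ card V"
    by (simp only: mult_1)
  then show ?case
    using insert.hyps by simp
qed

text \<open>The factor z for the compulsory variable is absorbed through z / (1 - z) = 1 / (1 - z) -
  1; this produces the differences of powers in the final formula.\<close>

lemma counting_series_multiples:
  assumes "finite V" "v \<in> V"
  shows "counting_series {m. Poly_Mapping.keys m \<subseteq> V \<and> v \<in> Poly_Mapping.keys m}
    = geom ^ card V - geom ^ (card V - 1)"
proof -
  obtain k where k: "card V = Suc k"
    using assms by (metis card_Suc_Diff1)
  have "counting_series {m. Poly_Mapping.keys m \<subseteq> V \<and> v \<in> Poly_Mapping.keys m} = fps_X * geom ^ card V"
    using assms(1) by (simp add: shift_eq_keys[OF assms(2)] counting_series_shift counting_series_free)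
  also have "\<dots> = (fps_X * geom) * geom ^ k"
    by (simp add: k mult.assoc)
  finally show ?thesis
    by (simp add: X_mult_geom k algebra_simps)
qed

section \<open>Supports of standard monomials\<close>

definition x_vars :: "nat \<Rightarrow> (nat \<times> nat) set" where
  "x_vars n = {3..n} \<times> {1}"

definition y_vars :: "nat \<Rightarrow> (nat \<times> nat) set" where
  "y_vars n = {3..n} \<times> {2}"

definition free_vars :: "nat \<Rightarrow> (nat \<times> nat) set" where
  "free_vars n = {1..n} \<times> {1..n} - insert (1, 1) (x_vars n \<union> y_vars n)"

text \<open>Besides the free variables these are y_3, ..., y_k and x_k, ..., x_n: the maximal sets
  of x's and y's without a pair x_i, y_j for i < j. They are the facets of the initial complex of
  the 2 x 2 minors of a generic matrix with two columns.\<close>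

definition chain_vars :: "nat \<Rightarrow> nat \<Rightarrow> (nat \<times> nat) set" where
  "chain_vars n k = free_vars n \<union> ({k..n} \<times> {1} \<union> {3..k} \<times> {2})"

lemma finite_vars [simp]:
  "finite (x_vars n)" "finite (y_vars n)" "finite (free_vars n)" "finite (chain_vars n k)"
  by (simp_all add: x_vars_def y_vars_def free_vars_def chain_vars_def)

lemma card_free_vars:
  assumes "3 \<le> n"
  shows "card (free_vars n) = n^2 - 2 * n + 3"
proof -
  have "card (insert (1, 1) (x_vars n \<union> y_vars n)) = Suc (card (x_vars n \<union> y_vars n))"
    by (rule card_insert_disjoint) (auto simp: x_vars_def y_vars_def)
  also have "card (x_vars n \<union> y_vars n) = (n - 2) + (n - 2)"
    by (subst card_Un_disjoint) (auto simp: x_vars_def y_vars_def)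
  finally have card: "card (insert (1, 1) (x_vars n \<union> y_vars n)) = Suc ((n - 2) + (n - 2))" .
  have "insert (1, 1) (x_vars n \<union> y_vars n) \<subseteq> {1..n} \<times> {1..n}"
    using assms by (auto simp: x_vars_def y_vars_def)
  then have "card (free_vars n) = card ({1..n} \<times> {1..n}) - card (insert (1, 1) (x_vars n \<union> y_vars n))"
    unfolding free_vars_def by (intro card_Diff_subset) simp_all
  then have "card (free_vars n) = n * n - Suc ((n - 2) + (n - 2))"
    unfolding card by (simp add: card_cartesian_product)
  \<comment> \<open>Ensures that no subtraction of natural numbers is truncated.\<close>
  moreover have "3 * n \<le> n * n"
    using assms by simp
  ultimately show ?thesis
    using assms by (simp add: power2_eq_square)
qed

lemma card_vars:
  assumes "3 \<le> n"
  shows "card (free_vars n \<union> x_vars n) = card (free_vars n) + (n - 2)"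
    "card (insert (1, 1) (free_vars n)) = card (free_vars n) + 1"
    "card (insert (1, 1) (free_vars n \<union> x_vars n)) = card (free_vars n) + (n - 1)"
    "card (insert (1, 1) (free_vars n \<union> y_vars n)) = card (free_vars n) + (n - 1)"
    "k \<in> {3..n} \<Longrightarrow> card (chain_vars n k) = card (free_vars n) + (n - 1)"
proof -
  show x: "card (free_vars n \<union> x_vars n) = card (free_vars n) + (n - 2)"
    by (subst card_Un_disjoint) (auto simp: free_vars_def x_vars_def y_vars_def)
  have y: "card (free_vars n \<union> y_vars n) = card (free_vars n) + (n - 2)"
    by (subst card_Un_disjoint) (auto simp: free_vars_def x_vars_def y_vars_def)
  have "(1, 1) \<notin> free_vars n \<union> x_vars n" "(1, 1) \<notin> free_vars n \<union> y_vars n"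
    by (auto simp: free_vars_def x_vars_def y_vars_def)
  then show "card (insert (1, 1) (free_vars n)) = card (free_vars n) + 1"
    "card (insert (1, 1) (free_vars n \<union> x_vars n)) = card (free_vars n) + (n - 1)"
    "card (insert (1, 1) (free_vars n \<union> y_vars n)) = card (free_vars n) + (n - 1)"
    using assms by (simp_all add: x y)
  assume k: "k \<in> {3..n}"
  let ?U = "{k..n} \<times> {1::nat} \<union> {3..k} \<times> {2}"
  have "card ?U = (Suc n - k) + (Suc k - 3)"
    by (subst card_Un_disjoint) auto
  also have "\<dots> = n - 1"
    using k by auto
  finally have "card ?U = n - 1" .
  moreover have "?U \<subseteq> x_vars n \<union> y_vars n"
    using k by (auto simp: x_vars_def y_vars_def)
  then have "free_vars n \<inter> ?U = {}"
    unfolding free_vars_def by blast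
  then have "card (chain_vars n k) = card (free_vars n) + card ?U"
    unfolding chain_vars_def by (intro card_Un_disjoint) simp_all
  ultimately show "card (chain_vars n k) = card (free_vars n) + (n - 1)"
    by simp
qed

text \<open>A Stanley decomposition, except that the last two sets overlap.\<close>

lemma standard_monomials_decomposition:
  assumes "3 \<le> n"
  shows "standard_monomials n = {m. Poly_Mapping.keys m \<subseteq> free_vars n \<union> x_vars n}
    \<union> (\<Union>k\<in>{3..n}. {m. Poly_Mapping.keys m \<subseteq> chain_vars n k \<and> (k, 2) \<in> Poly_Mapping.keys m})
    \<union> ({m. Poly_Mapping.keys m \<subseteq> insert (1, 1) (free_vars n \<union> x_vars n) \<and> (1, 1) \<in> Poly_Mapping.keys m}
      \<union> {m. Poly_Mapping.keys m \<subseteq> insert (1, 1) (free_vars n \<union> y_vars n) \<and> (1, 1) \<in> Poly_Mapping.keys m})"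
    (is "_ = ?F \<union> ?C \<union> ?A")
proof (intro equalityI subsetI)
  fix m
  assume m: "m \<in> standard_monomials n"
  have keys: "Poly_Mapping.keys m \<subseteq> {1..n} \<times> {1..n}"
    using m by (simp add: standard_monomials_def monomials_def)
  have xy: "(i, 1) \<notin> Poly_Mapping.keys m \<or> (j, 2) \<notin> Poly_Mapping.keys m" if "3 \<le> i" "i < j" "j \<le> n" for i j
    using standard_x_y[OF m that] by (simp add: in_keys_iff)
  have ayx: "(1, 1) \<notin> Poly_Mapping.keys m \<or> (i, 2) \<notin> Poly_Mapping.keys m \<or> (j, 1) \<notin> Poly_Mapping.keys m"
    if "3 \<le> i" "i \<le> j" "j \<le> n" for i j
    using standard_a_y_x[OF m that] by (simp add: in_keys_iff)
  show "m \<in> ?F \<union> ?C \<union> ?A"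
  proof (cases "(1, 1) \<in> Poly_Mapping.keys m")
    case True
    have "Poly_Mapping.keys m \<inter> x_vars n = {} \<or> Poly_Mapping.keys m \<inter> y_vars n = {}"
    proof (rule ccontr)
      assume "\<not> ?thesis"
      then obtain i j where ij: "(i, 1) \<in> Poly_Mapping.keys m" "(j, 2) \<in> Poly_Mapping.keys m"
        "3 \<le> i" "i \<le> n" "3 \<le> j" "j \<le> n"
        by (auto simp: x_vars_def y_vars_def)
      then show False
        using xy[of i j] ayx[of j i] True by force
    qed
    then have "m \<in> ?A"
      using keys True by (auto simp: free_vars_def)
    then show ?thesis by blast
  next
    case a: False
    show ?thesis
    proof (cases "Poly_Mapping.keys m \<inter> y_vars n = {}")
      case True
      then have "m \<in> ?F"
        using keys a by (auto simp: free_vars_def)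
      then show ?thesis by blast
    next
      case False
      \<comment> \<open>The largest row k with a y selects the piece: the y's stand in rows up to k
        by maximality, the x's in rows from k on by standardness.\<close>
      define J where "J = {j \<in> {3..n}. (j, 2) \<in> Poly_Mapping.keys m}"
      have J: "finite J" "J \<noteq> {}"
        using False by (auto simp: J_def y_vars_def)
      define k where "k = Max J"
      have "k \<in> J"
        unfolding k_def using J by (rule Max_in)
      then have k: "3 \<le> k" "k \<le> n" "(k, 2) \<in> Poly_Mapping.keys m"
        by (simp_all add: J_def)
      have "j \<le> k" if "(j, 2) \<in> Poly_Mapping.keys m" "3 \<le> j" "j \<le> n" for j
        unfolding k_def using that J by (intro Max_ge) (simp_all add: J_def)
      moreover have "k \<le> i" if "(i, 1) \<in> Poly_Mapping.keys m" "3 \<le> i" for i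
        using xy[of i k] k that by (meson not_le)
      ultimately have "Poly_Mapping.keys m \<subseteq> chain_vars n k"
        using keys a by (auto simp: chain_vars_def free_vars_def x_vars_def y_vars_def)
      then have "m \<in> ?C"
        using k by auto
      then show ?thesis by blast
    qed
  qed
next
  fix m
  have sub: "free_vars n \<subseteq> {1..n} \<times> {1..n}" "x_vars n \<subseteq> {1..n} \<times> {1..n}" "y_vars n \<subseteq> {1..n} \<times> {1..n}"
    "k \<in> {3..n} \<Longrightarrow> chain_vars n k \<subseteq> {1..n} \<times> {1..n}" for k
    using assms by (auto simp: free_vars_def x_vars_def y_vars_def chain_vars_def)
  have a: "(1, 1) \<in> {1..n} \<times> {1..n}"
    using assms by simp
  have mem: "(i, 1) \<notin> free_vars n" "(i, 2) \<notin> free_vars n" "(i, 1) \<notin> y_vars n" "(i, 2) \<notin> x_vars n"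
    if "3 \<le> i" "i \<le> n" for i
    using that by (auto simp: free_vars_def x_vars_def y_vars_def)
  have chain: "(i, 1) \<in> chain_vars n k \<Longrightarrow> 3 \<le> i \<Longrightarrow> k \<le> i" "(i, 2) \<in> chain_vars n k \<Longrightarrow> 3 \<le> i \<Longrightarrow> i \<le> k"
    "3 \<le> k \<Longrightarrow> (1, 1) \<notin> chain_vars n k" for i k
    by (auto simp: free_vars_def x_vars_def y_vars_def chain_vars_def)
  assume "m \<in> ?F \<union> ?C \<union> ?A"
  then consider (1) "Poly_Mapping.keys m \<subseteq> free_vars n \<union> x_vars n"
    | (2) k where "k \<in> {3..n}" "Poly_Mapping.keys m \<subseteq> chain_vars n k"
    | (3) "Poly_Mapping.keys m \<subseteq> insert (1, 1) (free_vars n \<union> x_vars n)"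
    | (4) "Poly_Mapping.keys m \<subseteq> insert (1, 1) (free_vars n \<union> y_vars n)"
    by blast
  \<comment> \<open>Standardness depends only on the support, so it is enough to find a set U of
    matrix variables that covers the support and contains the variables of no expected leading
    term.\<close>
  then obtain U where "Poly_Mapping.keys m \<subseteq> U" "U \<subseteq> {1..n} \<times> {1..n}"
    "\<And>i j. 3 \<le> i \<Longrightarrow> i < j \<Longrightarrow> j \<le> n \<Longrightarrow> (i, 1) \<notin> U \<or> (j, 2) \<notin> U"
    "\<And>i j. 3 \<le> i \<Longrightarrow> i \<le> j \<Longrightarrow> j \<le> n \<Longrightarrow> (1, 1) \<notin> U \<or> (i, 2) \<notin> U \<or> (j, 1) \<notin> U"
  proof cases
    case 1
    show ?thesis
      by (rule that[OF 1]) (use sub in \<open>simp_all add: mem del: One_nat_def\<close>)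
  next
    case (2 k)
    show ?thesis
    proof (rule that[OF 2(2) sub(4)[OF 2(1)]])
      show "(i, 1) \<notin> chain_vars n k \<or> (j, 2) \<notin> chain_vars n k" if "3 \<le> i" "i < j" "j \<le> n" for i j
        using chain(1)[of i k] chain(2)[of j k] that by linarith
      show "(1, 1) \<notin> chain_vars n k \<or> (i, 2) \<notin> chain_vars n k \<or> (j, 1) \<notin> chain_vars n k" for i j
        using chain(3)[of k] 2(1) by simp
    qed
  next
    case 3
    show ?thesis
      by (rule that[OF 3]) (use sub a in \<open>simp_all add: mem del: One_nat_def\<close>)
  next
    case 4
    show ?thesis
      by (rule that[OF 4]) (use sub a in \<open>simp_all add: mem del: One_nat_def\<close>)
  qed
  then have "Poly_Mapping.keys m \<subseteq> {1..n} \<times> {1..n} \<and>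
     (\<forall>i j. 3 \<le> i \<and> i < j \<and> j \<le> n \<longrightarrow> (i, 1) \<notin> Poly_Mapping.keys m \<or> (j, 2) \<notin> Poly_Mapping.keys m) \<and>
     (\<forall>i j. 3 \<le> i \<and> i \<le> j \<and> j \<le> n \<longrightarrow> (1, 1) \<notin> Poly_Mapping.keys m
        \<or> (i, 2) \<notin> Poly_Mapping.keys m \<or> (j, 1) \<notin> Poly_Mapping.keys m)"
    by blast
  then show "m \<in> standard_monomials n"
    by (simp add: standard_monomials_def monomials_def in_keys_iff)
qed

text \<open>Let w count the free variables and N = n - 2. The N pieces with largest y-row k and the
  two families containing a each contribute \<open>geom ^ (w + N + 1) - geom ^ (w + N)\<close>;
  monomials with neither a nor y contribute \<open>geom ^ (w + N)\<close>. This explains the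
  coefficients N + 2 = n and 1 - (N + 2) = -(n - 1). The last two terms remove the overlap, in which
  a occurs but no x or y.\<close>

lemma counting_series_standard:
  assumes n: "3 \<le> n"
  shows "counting_series (standard_monomials n) =
    of_nat n * geom ^ (n^2 - n + 2) - of_nat (n - 1) * geom ^ (n^2 - n + 1)
    - geom ^ (n^2 - 2 * n + 4) + geom ^ (n^2 - 2 * n + 3)"
proof -
  let ?c = "counting_series :: monomial set \<Rightarrow> rat fps"
  let ?V = "{1..n} \<times> {1..n}"
  let ?a = "(1, 1) :: nat \<times> nat"
  let ?F = "{m :: monomial. Poly_Mapping.keys m \<subseteq> free_vars n \<union> x_vars n}"
  let ?M = "\<lambda>k. {m :: monomial. Poly_Mapping.keys m \<subseteq> chain_vars n k \<and> (k, 2) \<in> Poly_Mapping.keys m}"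
  let ?C = "\<Union>k\<in>{3..n}. ?M k"
  let ?X = "{m :: monomial. Poly_Mapping.keys m \<subseteq> insert ?a (free_vars n \<union> x_vars n) \<and> ?a \<in> Poly_Mapping.keys m}"
  let ?Y = "{m :: monomial. Poly_Mapping.keys m \<subseteq> insert ?a (free_vars n \<union> y_vars n) \<and> ?a \<in> Poly_Mapping.keys m}"
  let ?Z = "{m :: monomial. Poly_Mapping.keys m \<subseteq> insert ?a (free_vars n) \<and> ?a \<in> Poly_Mapping.keys m}"
  define w where "w = card (free_vars n)"
  define N where "N = n - 2"
  have nN: "n = N + 2"
    using n by (simp add: N_def)
  note card = card_vars[OF n, folded w_def]
  have keys: "Poly_Mapping.keys m \<subseteq> ?V" if "m \<in> ?F \<union> ?C \<union> (?X \<union> ?Y)" for m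
    using that unfolding standard_monomials_decomposition[OF n, symmetric]
    by (simp add: standard_monomials_def monomials_def)
  have a: "?a \<notin> free_vars n \<union> x_vars n" "3 \<le> k \<Longrightarrow> ?a \<notin> chain_vars n k" for k
    by (auto simp: free_vars_def x_vars_def chain_vars_def)
  have y: "(k, 2) \<notin> free_vars n \<union> x_vars n" if "k \<in> {3..n}" for k
    using that by (auto simp: free_vars_def x_vars_def y_vars_def)
  have "disjoint_family_on ?M {3..n}"
    unfolding disjoint_family_on_def
  proof (intro ballI impI)
    fix k l
    assume kl: "k \<in> {3..n}" "l \<in> {3..n}" "k \<noteq> l"
    have "(k, 2) \<in> chain_vars n l \<Longrightarrow> k \<le> l" "(l, 2) \<in> chain_vars n k \<Longrightarrow> l \<le> k"
      using kl by (auto simp: free_vars_def y_vars_def chain_vars_def)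
    then show "?M k \<inter> ?M l = {}"
      using kl(3) by (auto simp: subset_iff)
  qed
  moreover have "Poly_Mapping.keys m \<subseteq> ?V" if "k \<in> {3..n}" "m \<in> ?M k" for k m
    using that by (intro keys) blast
  ultimately have "?c ?C = (\<Sum>k=3..n. ?c (?M k))"
    by (intro counting_series_UN_disjoint[of _ ?V]) simp_all
  also have "\<dots> = (\<Sum>k=3..n. geom ^ (w + N + 1) - geom ^ (w + N))"
  proof (rule sum.cong[OF refl])
    fix k
    assume k: "k \<in> {3..n}"
    then have "(k, 2) \<in> chain_vars n k"
      by (auto simp: chain_vars_def)
    from counting_series_multiples[OF finite_vars(4) this]
    show "?c (?M k) = geom ^ (w + N + 1) - geom ^ (w + N)"
      unfolding card(5)[OF k] by (simp add: nN)
  qed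
  also have "\<dots> = of_nat N * (geom ^ (w + N + 1) - geom ^ (w + N))"
    by (simp add: nN)
  finally have C: "?c ?C = of_nat N * (geom ^ (w + N + 1) - geom ^ (w + N))" .
  have F: "?c ?F = geom ^ (w + N)"
    by (subst counting_series_free) (simp_all add: card N_def)
  have X: "?c ?X = geom ^ (w + N + 1) - geom ^ (w + N)"
    using counting_series_multiples[of "insert ?a (free_vars n \<union> x_vars n)" ?a]
    unfolding card(3) by (simp add: nN)
  have Y: "?c ?Y = geom ^ (w + N + 1) - geom ^ (w + N)"
    using counting_series_multiples[of "insert ?a (free_vars n \<union> y_vars n)" ?a]
    unfolding card(4) by (simp add: nN)
  have Z: "?c ?Z = geom ^ (w + 1) - geom ^ w"
    using counting_series_multiples[of "insert ?a (free_vars n)" ?a]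
    unfolding card(2) by (simp add: nN)
  have "x_vars n \<inter> y_vars n = {}"
    by (auto simp: x_vars_def y_vars_def)
  then have XYZ: "?X \<inter> ?Y = ?Z"
    by blast
  have "?c (?X \<union> ?Y) + ?c (?X \<inter> ?Y) = ?c ?X + ?c ?Y"
    by (rule counting_series_Un_Int[of ?V]) (simp, rule keys, blast)
  then have XY: "?c (?X \<union> ?Y) = 2 * (geom ^ (w + N + 1) - geom ^ (w + N)) - (geom ^ (w + 1) - geom ^ w)"
    unfolding XYZ unfolding X Y Z by (simp add: eq_diff_eq)
  have "?F \<inter> ?C = {}"
    using y by blast
  have "?c (?F \<union> ?C) = ?c ?F + ?c ?C"
    by (rule counting_series_Un_disjoint[of ?V]) (simp, rule keys, blast, fact)
  moreover have "(?F \<union> ?C) \<inter> (?X \<union> ?Y) = {}"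
    using a by fastforce
  then have "?c (?F \<union> ?C \<union> (?X \<union> ?Y)) = ?c (?F \<union> ?C) + ?c (?X \<union> ?Y)"
    by (intro counting_series_Un_disjoint[of ?V] keys) simp_all
  ultimately have "?c (standard_monomials n) = geom ^ (w + N) + of_nat N * (geom ^ (w + N + 1) - geom ^ (w + N))
      + (2 * (geom ^ (w + N + 1) - geom ^ (w + N)) - (geom ^ (w + 1) - geom ^ w))"
    unfolding standard_monomials_decomposition[OF n] F C XY by simp
  also have "\<dots> = of_nat (N + 2) * geom ^ (w + N + 1) - of_nat (N + 1) * geom ^ (w + N) - geom ^ (w + 1) + geom ^ w"
    by (simp add: algebra_simps)
  finally have count: "?c (standard_monomials n) = of_nat n * geom ^ (w + N + 1) - of_nat (n - 1) * geom ^ (w + N)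
      - geom ^ (w + 1) + geom ^ w"
    by (simp add: nN)
  have w: "w = n^2 - 2 * n + 3"
    unfolding w_def by (rule card_free_vars[OF n])
  have "2 * n \<le> n^2"
    using n by (simp add: power2_eq_square)
  then have exponents: "w + N = n^2 - n + 1" "n^2 - n + 1 + 1 = n^2 - n + 2" "w + 1 = n^2 - 2 * n + 4"
    using n by (simp_all add: w N_def)
  show ?thesis
    unfolding count exponents by (simp only: w)
qed

section \<open>The Hilbert series\<close>

lemma const_in_carrier: "Poly_Mapping.single 0 c \<in> carrier (entry_ring n)"
  by (rule single_in_carrier) (simp add: monomials_def)

lemma homogeneous_part_0: "homogeneous_part n 0 = range (Poly_Mapping.single 0)"
proof (intro equalityI subsetI)
  fix p :: "'a entry_poly"
  assume p: "p \<in> homogeneous_part n 0"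
  have "m = 0" if m: "m \<in> Poly_Mapping.keys p" for m
  proof -
    have "mdegree m = 0"
      using p m unfolding homogeneous_part_def mdegree_def by blast
    then have "Poly_Mapping.lookup m v = 0" for v
      using lookup_le_mdegree[of m v] by simp
    then show ?thesis
      by (intro poly_mapping_eqI) simp
  qed
  then have "p = Poly_Mapping.single 0 (Poly_Mapping.lookup p 0)"
    by (intro poly_mapping_eqI) (auto simp: lookup_single when_def in_keys_iff)
  then show "p \<in> range (Poly_Mapping.single 0)"
    by blast
next
  fix p :: "'a entry_poly"
  assume "p \<in> range (Poly_Mapping.single 0)"
  then show "p \<in> homogeneous_part n 0"
    by (auto simp: homogeneous_part_def const_in_carrier split: if_splits)
qed

lemma subfield_constants:
  "subfield (range (Poly_Mapping.single 0)) (entry_ring n :: 'k::field entry_poly ring)"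
proof -
  let ?R = "entry_ring n :: 'k entry_poly ring" and ?K = "range (Poly_Mapping.single 0 :: 'k \<Rightarrow> 'k entry_poly)"
  interpret cring ?R by (rule cring_entry_ring)
  have sub: "?K \<subseteq> carrier ?R"
    using const_in_carrier by auto
  have "subcring ?K ?R"
  proof (rule subcringI', rule subringI)
    show "?K \<subseteq> carrier ?R" by (rule sub)
    show "\<one>\<^bsub>?R\<^esub> \<in> ?K"
      using rangeI[of "Poly_Mapping.single 0" "1 :: 'k"] by simp
    fix h k
    assume "h \<in> ?K" "k \<in> ?K"
    then obtain c d where cd: "h = Poly_Mapping.single 0 c" "k = Poly_Mapping.single 0 d"
      by blast
    show "\<ominus>\<^bsub>?R\<^esub> h \<in> ?K"
      unfolding cd a_inv_entry_ring[OF const_in_carrier] by (simp flip: single_uminus)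
    show "h \<otimes>\<^bsub>?R\<^esub> k \<in> ?K" "h \<oplus>\<^bsub>?R\<^esub> k \<in> ?K"
      by (simp_all add: cd mult_single flip: single_add)
  qed
  moreover have "Units (?R\<lparr>carrier := ?K\<rparr>) = ?K - {\<zero>\<^bsub>?R\<^esub>}"
  proof (intro equalityI subsetI)
    fix x
    assume "x \<in> Units (?R\<lparr>carrier := ?K\<rparr>)"
    then obtain y where "x \<in> ?K" "x * y = 1"
      unfolding Units_def by auto
    then show "x \<in> ?K - {\<zero>\<^bsub>?R\<^esub>}"
      by auto
  next
    fix x
    assume "x \<in> ?K - {\<zero>\<^bsub>?R\<^esub>}"
    then obtain c where c: "x = Poly_Mapping.single 0 c"
      by blast
    with \<open>x \<in> ?K - {\<zero>\<^bsub>?R\<^esub>}\<close> have "c \<noteq> 0"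
      by auto
    with c have inv: "x * Poly_Mapping.single 0 (inverse c) = 1"
      by (simp add: mult_single)
    then show "x \<in> Units (?R\<lparr>carrier := ?K\<rparr>)"
      unfolding Units_def using c
      by (auto simp: mult.commute intro!: bexI[of _ "Poly_Mapping.single 0 (inverse c)"])
  qed
  ultimately show ?thesis
    by (rule subfieldI)
qed

text \<open>The predicate \<open>dimension\<close> is inductive, growing by line extensions; each
  monomial adds one line over the constants.\<close>

lemma dimension_monomial_span:
  assumes "finite T" "T \<subseteq> monomials n"
  shows "ring.dimension (entry_ring n) (card T) (range (Poly_Mapping.single 0))
    {p :: 'k::field entry_poly. Poly_Mapping.keys p \<subseteq> T}"
  using assms
proof (induction T rule: finite_induct)
  case empty
  interpret cring "entry_ring n :: 'k entry_poly ring" by (rule cring_entry_ring)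
  have "{p :: 'k entry_poly. Poly_Mapping.keys p \<subseteq> {}} = {\<zero>\<^bsub>entry_ring n\<^esub>}"
    by auto
  then show ?case
    using zero_dim by simp
next
  case (insert m T)
  let ?K = "range (Poly_Mapping.single 0 :: 'k \<Rightarrow> 'k entry_poly)"
  let ?E = "\<lambda>T. {p :: 'k entry_poly. Poly_Mapping.keys p \<subseteq> T}"
  interpret cring "entry_ring n :: 'k entry_poly ring" by (rule cring_entry_ring)
  have "line_extension ?K (Poly_Mapping.single m 1) (?E T) = ?E (insert m T)"
  proof (intro equalityI subsetI)
    fix p
    assume "p \<in> line_extension ?K (Poly_Mapping.single m 1) (?E T)"
    then obtain c q where "p = Poly_Mapping.single m c + q" "Poly_Mapping.keys q \<subseteq> T"
      by (auto simp: line_extension_def set_add_def' r_coset_def mult_single)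
    then show "p \<in> ?E (insert m T)"
      using Poly_Mapping.keys_add[of "Poly_Mapping.single m c" q] by (auto split: if_splits)
  next
    fix p
    assume p: "p \<in> ?E (insert m T)"
    let ?c = "Poly_Mapping.lookup p m"
    have "Poly_Mapping.keys (p - Poly_Mapping.single m ?c) \<subseteq> T"
      using p by (auto simp: in_keys_iff lookup_minus lookup_single when_def split: if_splits)
    moreover have "p = Poly_Mapping.single 0 ?c * Poly_Mapping.single m 1 + (p - Poly_Mapping.single m ?c)"
      by (simp add: mult_single)
    ultimately have "\<exists>c q. Poly_Mapping.keys q \<subseteq> T \<and> p = Poly_Mapping.single 0 c * Poly_Mapping.single m 1 + q"
      by blast
    then show "p \<in> line_extension ?K (Poly_Mapping.single m 1) (?E T)"
      by (auto simp: line_extension_def set_add_def' r_coset_def)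
  qed
  moreover have "Poly_Mapping.single m 1 \<notin> ?E T"
    using insert.hyps by simp
  moreover have "Poly_Mapping.single m 1 \<in> carrier (entry_ring n :: 'k entry_poly ring)"
    using insert.prems by (intro single_in_carrier) simp
  ultimately have "dimension (Suc (card T)) ?K (?E (insert m T))"
    using Suc_dim[of "Poly_Mapping.single m 1" "?E T" "card T" ?K] insert.IH insert.prems by auto
  then show ?case
    by (simp only: card_insert_disjoint[OF insert.hyps])
qed

text \<open>The residue map sends the span of the standard monomials of degree d injectively into
  the quotient, by independence, and onto its degree d part, because reduction preserves
  degree.\<close>

lemma dim_quotient_part:
  assumes n: "3 \<le> n"
  shows "ring.dim (entry_ring n Quot kalman_ideal n) (quotient_part n (kalman_ideal n) 0)
      (quotient_part n (kalman_ideal n :: 'k::field entry_poly set) d)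
    = card {m \<in> standard_monomials n. mdegree m = d}"
proof -
  let ?R = "entry_ring n :: 'k entry_poly ring" and ?I = "kalman_ideal n :: 'k entry_poly set"
  let ?K = "range (Poly_Mapping.single 0 :: 'k \<Rightarrow> 'k entry_poly)"
  define T where "T = {m \<in> standard_monomials n. mdegree m = d}"
  let ?E = "{p :: 'k entry_poly. Poly_Mapping.keys p \<subseteq> T}"
  have I: "?I = param_kernel n"
    by (rule kalman_ideal_eq_kernel[OF n])
  \<comment> \<open>Primality makes the quotient a domain and so supplies 1 \<noteq> 0, which the
    transfer of dimensions along the residue map requires.\<close>
  interpret primeideal ?I ?R
    unfolding I by (rule primeideal_param_kernel)
  interpret Q: domain "?R Quot ?I"
    by (rule quotient_is_domain)
  interpret hom: ring_hom_ring ?R "?R Quot ?I" "(+>\<^bsub>?R\<^esub>) ?I"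
    by (rule rcos_ring_hom_ring)
  have T: "finite T" "T \<subseteq> monomials n" "T \<subseteq> standard_monomials n"
  proof -
    have "Poly_Mapping.keys m \<subseteq> {1..n} \<times> {1..n}" if "m \<in> standard_monomials n" for m
      using that by (simp add: standard_monomials_def monomials_def)
    then show "finite T"
      unfolding T_def by (intro finite_degree_part[of "{1..n} \<times> {1..n}"]) simp_all
    show "T \<subseteq> standard_monomials n"
      unfolding T_def by blast
    then show "T \<subseteq> monomials n"
      using standard_subset_monomials by blast
  qed
  have coset_eq: "?I +>\<^bsub>?R\<^esub> p = ?I +>\<^bsub>?R\<^esub> q \<longleftrightarrow> p - q \<in> ?I"
    if "p \<in> carrier ?R" "q \<in> carrier ?R" for p q
  proof -
    have "p \<ominus>\<^bsub>?R\<^esub> q = p - q"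
      using that by (simp add: a_minus_def a_inv_entry_ring)
    then show ?thesis
      using quotient_eq_iff_same_a_r_cos[OF is_ideal that] by simp
  qed
  have E: "?E \<subseteq> carrier ?R"
    using T by (auto simp: carrier_entry_ring)
  have "inj_on ((+>\<^bsub>?R\<^esub>) ?I) ?E"
  proof (rule inj_onI)
    fix p q
    assume pq: "p \<in> ?E" "q \<in> ?E" and eq: "?I +>\<^bsub>?R\<^esub> p = ?I +>\<^bsub>?R\<^esub> q"
    have "p \<in> carrier ?R" "q \<in> carrier ?R"
      using E pq by blast+
    from iffD1[OF coset_eq[OF this] eq] have "param n (p - q) = 0"
      unfolding I by (simp add: param_kernel_def)
    moreover have "Poly_Mapping.keys (p - q) \<subseteq> standard_monomials n"
      using pq T(3) keys_diff[of p q] by blast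
    ultimately have "p - q = 0"
      by (rule standard_independent[rotated])
    then show "p = q" by simp
  qed
  then have "Q.dimension (card T) ((+>\<^bsub>?R\<^esub>) ?I ` ?K) ((+>\<^bsub>?R\<^esub>) ?I ` ?E)"
    using hom.inj_hom_dimension[OF subfield_constants Q.one_not_zero] dimension_monomial_span[OF T(1,2)] by blast
  moreover have "(+>\<^bsub>?R\<^esub>) ?I ` ?E = quotient_part n ?I d"
  proof (intro equalityI subsetI)
    fix X
    assume "X \<in> (+>\<^bsub>?R\<^esub>) ?I ` ?E"
    then obtain p where p: "X = ?I +>\<^bsub>?R\<^esub> p" "p \<in> ?E"
      by blast
    then have "p \<in> homogeneous_part n d"
      using E by (auto simp: homogeneous_part_def T_def mdegree_def)
    then show "X \<in> quotient_part n ?I d"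
      by (simp add: quotient_part_def p(1))
  next
    fix X
    assume "X \<in> quotient_part n ?I d"
    then obtain p where p: "X = ?I +>\<^bsub>?R\<^esub> p" "p \<in> carrier ?R" "\<And>m. m \<in> Poly_Mapping.keys p \<Longrightarrow> mdegree m = d"
      by (auto simp: quotient_part_def homogeneous_part_def mdegree_def)
    obtain r where r: "p - r \<in> ?I" "\<forall>\<mu>\<in>Poly_Mapping.keys r. \<exists>m\<in>Poly_Mapping.keys p.
        \<mu> \<in> standard_monomials n \<and> \<mu> \<le> m \<and> mdegree \<mu> = mdegree m"
      using reduce_polynomial[OF is_ideal generators_subset_kalman[OF n] p(2)] by blast
    have "r \<in> ?E"
      using r(2) p(3) by (force simp: T_def)
    moreover have "?I +>\<^bsub>?R\<^esub> p = ?I +>\<^bsub>?R\<^esub> r"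
      using coset_eq[OF p(2)] r(1) E \<open>r \<in> ?E\<close> by blast
    ultimately show "X \<in> (+>\<^bsub>?R\<^esub>) ?I ` ?E"
      unfolding p(1) by blast
  qed
  moreover have "(+>\<^bsub>?R\<^esub>) ?I ` ?K = quotient_part n ?I 0"
    by (simp add: quotient_part_def homogeneous_part_0)
  ultimately have dim: "Q.dimension (card T) (quotient_part n ?I 0) (quotient_part n ?I d)"
    by simp
  moreover have "subfield (quotient_part n ?I 0) (?R Quot ?I)"
    using hom.img_is_subfield(2)[OF subfield_constants Q.one_not_zero]
    by (simp add: quotient_part_def homogeneous_part_0)
  \<comment> \<open>Here \<open>dim\<close> is a definite description, so existence of a dimension
    is not enough; uniqueness comes from the constants forming a subfield of the quotient.\<close>
  ultimately have "(THE k. Q.dimension k (quotient_part n ?I 0) (quotient_part n ?I d)) = card T"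
    using Q.dimension_is_inj by (intro the_equality) blast+
  then show ?thesis
    by (simp add: Q.dim_def T_def)
qed

lemma divide_by_one_minus_X_power:
  fixes f :: "rat fps"
  shows "f / (1 - fps_X) ^ k = f * geom ^ k"
  by (subst fps_divide_unit) (simp_all add: fps_inverse_power)

theorem theorem3p2:
  fixes n :: nat
  assumes "n \<ge> 3"
  shows "primeideal (kalman_ideal n :: 'k::alg_closed_field entry_poly set) (entry_ring n)
    \<and> card (quadrics n :: 'k entry_poly set) = (n - 2) choose 2
    \<and> card (cubics n :: 'k entry_poly set) = (n - 1) choose 2
    \<and> minimally_generates (entry_ring n) (quadrics n \<union> cubics n)
        (kalman_ideal n :: 'k entry_poly set)
    \<and> is_groebner_basis n (quadrics n \<union> cubics n) (kalman_ideal n :: 'k entry_poly set)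
    \<and> (\<forall>i j. 3 \<le> i \<and> i < j \<and> j \<le> n \<longrightarrow>
          leading_term (quadric i j :: 'k entry_poly) = entry i 1 * entry j 2)
    \<and> (\<forall>i j. 3 \<le> i \<and> i \<le> j \<and> j \<le> n \<longrightarrow>
          leading_term (cubic i j :: 'k entry_poly) = entry 1 1 * entry i 2 * entry j 1)
    \<and> hilbert_series n (kalman_ideal n :: 'k entry_poly set) =
          fps_const (of_nat n) / (1 - fps_X) ^ (n^2 - n + 2)
          - fps_const (of_nat (n - 1)) / (1 - fps_X) ^ (n^2 - n + 1)
          - 1 / (1 - fps_X) ^ (n^2 - 2 * n + 4)
          + 1 / (1 - fps_X) ^ (n^2 - 2 * n + 3)"
proof (intro conjI allI impI)
  show "primeideal (kalman_ideal n :: 'k entry_poly set) (entry_ring n)"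
    unfolding kalman_ideal_eq_kernel[OF assms] by (rule primeideal_param_kernel)
  show "leading_term (quadric i j :: 'k entry_poly) = entry i 1 * entry j 2"
    if "3 \<le> i \<and> i < j \<and> j \<le> n" for i j
    using leading_term_quadric[of i j, where 'k='k] that by (simp add: entry_def mult_single)
  show "leading_term (cubic i j :: 'k entry_poly) = entry 1 1 * entry i 2 * entry j 1"
    if "3 \<le> i \<and> i \<le> j \<and> j \<le> n" for i j
    using leading_term_cubic[of i j, where 'k='k] that by (simp add: entry_def mult_single)
  have "hilbert_series n (kalman_ideal n :: 'k entry_poly set) = counting_series (standard_monomials n)"
    by (simp add: hilbert_series_def counting_series_def dim_quotient_part[OF assms])
  then show "hilbert_series n (kalman_ideal n :: 'k entry_poly set) =
          fps_const (of_nat n) / (1 - fps_X) ^ (n^2 - n + 2)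
          - fps_const (of_nat (n - 1)) / (1 - fps_X) ^ (n^2 - n + 1)
          - 1 / (1 - fps_X) ^ (n^2 - 2 * n + 4)
          + 1 / (1 - fps_X) ^ (n^2 - 2 * n + 3)"
    unfolding counting_series_standard[OF assms] divide_by_one_minus_X_power
    by (simp add: fps_of_nat)
qed (rule card_quadrics[OF assms] card_cubics[OF assms]
    minimally_generates_generators[OF assms] groebner_basis_generators[OF assms])+

end
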